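(* Let $d\in\mathbb{N}$, $p\in[-\infty,1)$, $q\in\mathbb{N}_0$ and let $0\le k_0<k_1<\dots<k_q\le d$ be integers. Let $K=K_{k_0,\dots,k_q}\in\mathbb{R}^{(d+1)^2\times s}$, $s=\sum_{\ell=0}^q(2k_\ell+1)$, be the selection matrix for which $K^Tc$ is the vector of coefficients $\{c_{k_\ell}^m: m=-k_\ell,\dots,k_\ell;\ \ell=0,\dots,q\}$. Then the uniform distribution on the sphere, $$\xi^*(d\theta,d\phi)=\frac{1}{4\pi}\sin\theta\,d\theta\,d\phi \quad\text{on } [0,\pi]\times(-\pi,\pi],$$ is a $\Phi_p$-optimal design for estimating $K^Tc$ in the spherical harmonic regression model of degree $d$. Moreover, the information matrix of $\xi^*$ in this model is $M(\xi^* )=I_{(d+1)^2}$.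
   Context: Spherical harmonic functions: for $n\in\mathbb{N}_0$, $Y_n^0(\theta,\phi)=\sqrt{2n+1}\,P_n(\cos\theta)$ with $P_n$ the $n$-th Legendre polynomial; for $1\le m\le n$, $Y_n^m(\theta,\phi)=\sqrt{2(2n+1)\frac{(n-m)!}{(n+m)!}}\,P_n^m(\cos\theta)\cos(m\phi)$ and $Y_n^{-m}(\theta,\phi)=\sqrt{2(2n+1)\frac{(n-m)!}{(n+m)!}}\,P_n^m(\cos\theta)\sin(m\phi)$, where $P_n^m(x)=(-1)^m(1-x^2)^{m/2}\frac{d^m}{dx^m}P_n(x)$ is the associated Legendre function; these functions are orthonormal with respect to $\frac{1}{4\pi}\sin\theta\,d\theta\,d\phi$ on $[0,\pi]\times(-\pi,\pi]$. The spherical harmonic regression model of degree $d$ is $E[Y\mid\theta,\phi]=c^Tf_d(\theta,\phi)$, $\mathrm{Var}[Y\mid\theta,\phi]=\sigma^2>0$, with $f_d=(Y_0^0,Y_1^{-1},Y_1^0,Y_1^1,\dots,Y_d^{-d},\dots,Y_d^d)^T\in\mathbb{R}^{(d+1)^2}$ and $c=(c_0^0,c_1^{-1},c_1^0,c_1^1,\dots,c_d^{-d},\dots,c_d^d)^T$. A design is a probability measure $\xi$ on $[0,\pi]\times(-\pi,\pi]$; its information matrix is $M(\xi)=\int f_d f_d^T\,d\xi$. For a matrix $K$ of rank $s$, $K^Tc$ is estimable under $\xi$ if $\mathrm{range}(K)\subset\mathrm{range}(M(\xi))$; for such $\xi$ set $C_K(\xi)=(K^TM^-(\xi)K)^{-1}$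 ($M^-$ a generalized inverse) and $\Phi_p(\xi)=(\mathrm{tr}\,C_K(\xi)^{p})^{1/p}$ for $p\in(-\infty,1)\setminus\{0\}$, $\Phi_0(\xi)=\det C_K(\xi)$, $\Phi_{-\infty}(\xi)=\lambda_{\min}(C_K(\xi))$. A design is $\Phi_p$-optimal for estimating $K^Tc$ if it maximizes $\Phi_p$ among all designs under which $K^Tc$ is estimable. *)

theory Defs
  imports "HOL-Probability.Probability" "HOL-Library.Discrete_Functions"
    "Jordan_Normal_Form.Determinant" "Jordan_Normal_Form.Char_Poly"
begin

text \<open>Rodrigues' formula: P_n(x) = 1/(2^n n!) (d/dx)^n (x^2-1)^n.\<close>
definition legendre_poly :: "nat \<Rightarrow> real poly" where
  "legendre_poly n = Polynomial.smult (1 / (2 ^ n * fact n)) ((pderiv ^^ n) ([:-1, 0, 1:] ^ n))"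

definition assoc_legendre :: "nat \<Rightarrow> nat \<Rightarrow> real \<Rightarrow> real" where
  "assoc_legendre n m x = (-1) ^ m * sqrt (1 - x\<^sup>2) ^ m * poly ((pderiv ^^ m) (legendre_poly n)) x"

definition sph_harm :: "nat \<Rightarrow> int \<Rightarrow> real \<times> real \<Rightarrow> real" where
  "sph_harm n m = (\<lambda>(\<theta>, \<phi>).
     if m = 0 then sqrt (2 * real n + 1) * poly (legendre_poly n) (cos \<theta>)
     else if m > 0 then
       sqrt (2 * (2 * real n + 1) * fact (n - nat m) / fact (n + nat m))
         * assoc_legendre n (nat m) (cos \<theta>) * cos (real_of_int m * \<phi>)
     else
       sqrt (2 * (2 * real n + 1) * fact (n - nat (- m)) / fact (n + nat (- m)))
         * assoc_legendre n (nat (- m)) (cos \<theta>) * sin (real_of_int (- m) * \<phi>))"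

text \<open>The i-th (0-based) entry of (Y_0^0, Y_1^{-1}, Y_1^0, Y_1^1, ..., Y_d^{-d}, ..., Y_d^d):
  i = n^2 + n + m with -n <= m <= n, i.e. n = floor(sqrt i).\<close>
definition sh_deg :: "nat \<Rightarrow> nat" where
  "sh_deg i = floor_sqrt i"

definition sh_ord :: "nat \<Rightarrow> int" where
  "sh_ord i = int i - int (sh_deg i ^ 2) - int (sh_deg i)"

definition sh_f :: "nat \<Rightarrow> real \<times> real \<Rightarrow> real" where
  "sh_f i x = sph_harm (sh_deg i) (sh_ord i) x"

definition sh_dim :: "nat \<Rightarrow> nat" where
  "sh_dim d = (d + 1) ^ 2"

definition sphere_dom :: "(real \<times> real) set" where
  "sphere_dom = {0..pi} \<times> {-pi<..pi}"

definition design :: "(real \<times> real) measure \<Rightarrow> bool" where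
  "design \<xi> \<longleftrightarrow> prob_space \<xi> \<and> sets \<xi> = sets (restrict_space borel sphere_dom)"

definition xi_unif :: "(real \<times> real) measure" where
  "xi_unif = density (restrict_space lborel sphere_dom)
              (\<lambda>(\<theta>, \<phi>). ennreal (sin \<theta> / (4 * pi)))"

definition info_mat :: "nat \<Rightarrow> (real \<times> real) measure \<Rightarrow> real mat" where
  "info_mat d \<xi> = mat (sh_dim d) (sh_dim d)
     (\<lambda>(i, j). integral\<^sup>L \<xi> (\<lambda>x. sh_f i x * sh_f j x))"

text \<open>Indices (0-based) of the coefficients c_k^{-k},...,c_k^k for k in ks, in order.\<close>
definition sel_indices :: "nat list \<Rightarrow> nat list" where
  "sel_indices ks = concat (map (\<lambda>k. [k\<^sup>2 ..< (k + 1)\<^sup>2]) ks)"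

definition sel_matrix :: "nat \<Rightarrow> nat list \<Rightarrow> real mat" where
  "sel_matrix d ks = mat (sh_dim d) (length (sel_indices ks))
     (\<lambda>(i, j). if i = sel_indices ks ! j then 1 else 0)"

definition mat_range :: "real mat \<Rightarrow> real vec set" where
  "mat_range A = {A *\<^sub>v x | x. x \<in> carrier_vec (dim_col A)}"

definition estimable :: "nat \<Rightarrow> real mat \<Rightarrow> (real \<times> real) measure \<Rightarrow> bool" where
  "estimable d K \<xi> \<longleftrightarrow> mat_range K \<subseteq> mat_range (info_mat d \<xi>)"

definition gen_inverse :: "real mat \<Rightarrow> real mat" where
  "gen_inverse M = (SOME G. G \<in> carrier_mat (dim_col M) (dim_row M) \<and> M * G * M = M)"

definition mat_inv :: "real mat \<Rightarrow> real mat" where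
  "mat_inv A = (SOME B. B \<in> carrier_mat (dim_row A) (dim_row A)
                    \<and> A * B = 1\<^sub>m (dim_row A) \<and> B * A = 1\<^sub>m (dim_row A))"

definition C_K :: "nat \<Rightarrow> real mat \<Rightarrow> (real \<times> real) measure \<Rightarrow> real mat" where
  "C_K d K \<xi> = mat_inv (transpose_mat K * gen_inverse (info_mat d \<xi>) * K)"

definition mat_trace :: "real mat \<Rightarrow> real" where
  "mat_trace A = (\<Sum>i<dim_row A. A $$ (i, i))"

definition diag_of :: "nat \<Rightarrow> (nat \<Rightarrow> real) \<Rightarrow> real mat" where
  "diag_of n l = mat n n (\<lambda>(i, j). if i = j then l i else 0)"

definition mat_rpow :: "real mat \<Rightarrow> real \<Rightarrow> real mat" where
  "mat_rpow C p = (SOME P. \<exists>U l. U \<in> carrier_mat (dim_row C) (dim_row C)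
       \<and> transpose_mat U * U = 1\<^sub>m (dim_row C) \<and> (\<forall>i < dim_row C. l i > 0)
       \<and> C = U * diag_of (dim_row C) l * transpose_mat U
       \<and> P = U * diag_of (dim_row C) (\<lambda>i. l i powr p) * transpose_mat U)"

definition lambda_min :: "real mat \<Rightarrow> real" where
  "lambda_min C = Min {e. eigenvalue C e}"

definition Phi :: "nat \<Rightarrow> real mat \<Rightarrow> ereal \<Rightarrow> (real \<times> real) measure \<Rightarrow> real" where
  "Phi d K p \<xi> =
     (if p = -\<infinity> then lambda_min (C_K d K \<xi>)
      else if p = 0 then det (C_K d K \<xi>)
      else mat_trace (mat_rpow (C_K d K \<xi>) (real_of_ereal p)) powr (1 / real_of_ereal p))"

definition phi_optimal :: "nat \<Rightarrow> real mat \<Rightarrow> ereal \<Rightarrow> (real \<times> real) measure \<Rightarrow> bool" where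
  "phi_optimal d K p \<xi> \<longleftrightarrow> design \<xi> \<and> estimable d K \<xi> \<and>
     (\<forall>\<eta>. design \<eta> \<and> estimable d K \<eta> \<longrightarrow> Phi d K p \<eta> \<le> Phi d K p \<xi>)"

end

theory Submission
  imports Defs "Jordan_Normal_Form.Schur_Decomposition"
    "HOL-Computational_Algebra.Fundamental_Theorem_Algebra"
begin

unbundle no vec_syntax and no inner_syntax

text \<open>
  Everything rests on the diagonal case of the addition theorem,
  \<open>Y\<^sub>n\<^sup>-\<^sup>n(x)\<^sup>2 + \<dots> + Y\<^sub>n\<^sup>n(x)\<^sup>2 = 2n + 1\<close> at every point \<open>x\<close>. In terms of Legendre
  functions the derivative of the left-hand side telescopes by the differentiated Legendre equation,
  so the sum is constant. Integrating it over the sphere also gives the norms of the Legendre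
  functions, hence the information matrix of the uniform design.

  For a competing design with information matrix \<open>M\<close>, estimability means \<open>K = M Z\<close>, and then
  \<open>C = (Z\<^sup>T M Z)\<^sup>-\<^sup>1\<close>. Since \<open>K\<^sup>T K = I\<close>, expanding \<open>(Z C - K)\<^sup>T M (Z C - K) \<ge> 0\<close> yields
  \<open>C \<le> K\<^sup>T M K\<close>. By the addition theorem the trace of \<open>K\<^sup>T M K\<close> equals \<open>s\<close> for every
  design, so the eigenvalues of \<open>C\<close> have sum at most \<open>s\<close>, and
  each criterion is then at most its value at the identity matrix.
\<close>

section \<open>Legendre polynomials\<close>

text \<open>The addition theorem replaces averaging over rotations: it fixes the trace of every
  degree block of \<open>M\<close> for each single design, so a competitor is compared with the
  uniform design directly. This is why whole degrees are selected; part of a degree would in general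
  leave a trace that depends on the design. The target of the comparison is the identity, all of
  whose eigenvalues are 1, and so every scalar inequality used at the end is a tangent line at 1.

  Choice operators are the other obstacle. \<open>gen_inverse\<close> returns an unknown generalized
  inverse \<open>G\<close>, but estimability makes \<open>K^T G K\<close> the same for all of them.
  \<open>mat_inv\<close> is settled by uniqueness. \<open>mat_rpow\<close> works with an unknown
  orthogonal diagonalization, so traces of powers are computed from whichever one was chosen. The
  real spectral theorem shows that the objects to be chosen exist.\<close>

lemma real_poly_ext:
  fixes P Q :: "real poly"
  assumes "\<And>x. poly P x = poly Q x"
  shows "P = Q"
proof -
  have "poly P = poly Q" using assms by (rule ext)
  then show ?thesis by (simp only: poly_eq_poly_eq_iff)
qed

text \<open>At the root, only the Leibniz term that spends all \<open>k\<close> derivatives on the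
  power survives. In the induction one derivative lowers the power and changes the cofactor to
  \<open>(k + 1) q + l q'\<close>, which is why \<open>q\<close> is arbitrary.\<close>

lemma poly_pderiv_funpow_root_power:
  fixes a :: "'a::field_char_0"
  shows "poly ((pderiv ^^ k) ([:-a, 1:] ^ k * q)) a = fact k * poly q a"
proof (induction k arbitrary: q)
  case (Suc k)
  define l where "l = [:-a, 1:]"
  have l: "pderiv l = 1" by (simp add: l_def pderiv_pCons)
  have "pderiv (l ^ Suc k * q) = l ^ k * (Polynomial.smult (of_nat (Suc k)) q + l * pderiv q)"
    unfolding pderiv_mult pderiv_power_Suc l by (simp add: algebra_simps)
  then have "(pderiv ^^ Suc k) (l ^ Suc k * q)
      = (pderiv ^^ k) (l ^ k * (Polynomial.smult (of_nat (Suc k)) q + l * pderiv q))"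
    by (simp only: funpow_Suc_right o_apply)
  then show ?case
    using Suc.IH[of "Polynomial.smult (of_nat (Suc k)) q + l * pderiv q"]
    unfolding l_def by (simp del: funpow.simps of_nat_Suc add: mult.assoc)
qed simp

lemma legendre_poly_at_1: "poly (legendre_poly n) 1 = 1"
proof -
  have "[:-1, 0, 1:] = [:-1, 1:] * [:1, 1::real:]" by simp
  then have "[:-1, 0, 1:] ^ n = [:-1, 1:] ^ n * [:1, 1::real:] ^ n" by (metis power_mult_distrib)
  then show ?thesis
    using poly_pderiv_funpow_root_power[of n "1::real" "[:1, 1:] ^ n"]
    by (simp add: legendre_poly_def)
qed

lemma pderiv_funpow_smult: "(pderiv ^^ k) (Polynomial.smult c p) = Polynomial.smult c ((pderiv ^^ k) p)"
  by (induction k) (simp_all add: pderiv_smult)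

text \<open>The power satisfies \<open>(x^2 - 1) g' = 2 n x g\<close>, and this is that equation
  differentiated \<open>k + 1\<close> times. Each step lifts the identity from values to polynomials
  so that it can be differentiated again.\<close>

lemma pderiv_funpow_quadratic_power:
  fixes n :: nat
  defines "g \<equiv> [:-1, 0, 1::real:] ^ n"
  shows "(x\<^sup>2 - 1) * poly ((pderiv ^^ Suc (Suc k)) g) x
    = (2 * real n - 2 * real (Suc k)) * x * poly ((pderiv ^^ Suc k) g) x
      + real (Suc k) * (2 * real n - real k) * poly ((pderiv ^^ k) g) x"
proof (induction k arbitrary: x)
  case 0
  have "poly ([:-1, 0, 1:] * pderiv g) y = poly ([:0, 2 * real n:] * g) y" for y
  proof (cases n)
    case (Suc m)
    show ?thesis unfolding g_def Suc pderiv_power_Suc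
      by (simp add: pderiv_pCons algebra_simps)
  qed (simp add: g_def)
  then have "[:-1, 0, 1:] * pderiv g = [:0, 2 * real n:] * g"
    by (rule real_poly_ext)
  then have "pderiv ([:-1, 0, 1:] * pderiv g) = pderiv ([:0, 2 * real n:] * g)" by (rule arg_cong)
  from arg_cong[OF this, of "\<lambda>p. poly p x"] show ?case
    unfolding pderiv_mult by (simp add: pderiv_smult pderiv_pCons algebra_simps power2_eq_square)
next
  case (Suc k)
  define h where "h = (pderiv ^^ k) g"
  have "poly ([:-1, 0, 1:] * pderiv (pderiv h)) y
    = poly ([:0, 2 * real n - 2 * real (Suc k):] * pderiv h + Polynomial.smult (real (Suc k) * (2 * real n - real k)) h) y" for y
    using Suc[of y] unfolding h_def by (simp add: algebra_simps power2_eq_square)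
  then have "[:-1, 0, 1:] * pderiv (pderiv h)
    = [:0, 2 * real n - 2 * real (Suc k):] * pderiv h + Polynomial.smult (real (Suc k) * (2 * real n - real k)) h"
    by (rule real_poly_ext)
  then have "pderiv ([:-1, 0, 1:] * pderiv (pderiv h))
    = pderiv ([:0, 2 * real n - 2 * real (Suc k):] * pderiv h + Polynomial.smult (real (Suc k) * (2 * real n - real k)) h)"
    by (rule arg_cong)
  from arg_cong[OF this, of "\<lambda>p. poly p x"] show ?case
    unfolding funpow.simps o_apply h_def[symmetric] pderiv_mult pderiv_add
    by (simp add: pderiv_mult pderiv_add pderiv_smult pderiv_pCons algebra_simps power2_eq_square)
qed

definition legendre_deriv :: "nat \<Rightarrow> nat \<Rightarrow> real poly" where
  "legendre_deriv n m = (pderiv ^^ m) (legendre_poly n)"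

lemma legendre_deriv_0 [simp]: "legendre_deriv n 0 = legendre_poly n"
  by (simp add: legendre_deriv_def)

lemma pderiv_legendre_deriv [simp]: "pderiv (legendre_deriv n m) = legendre_deriv n (Suc m)"
  by (simp add: legendre_deriv_def)

text \<open>The Legendre equation differentiated \<open>m\<close> times. It is the preceding
  identity at \<open>k = n + m\<close>, since Rodrigues' formula already contains \<open>n\<close>
  derivatives; the signs flip on passing from \<open>x^2 - 1\<close> to
  \<open>1 - x^2\<close>.\<close>

lemma legendre_deriv_recurrence:
  "(1 - x\<^sup>2) * poly (legendre_deriv n (Suc (Suc m))) x
    = 2 * real (Suc m) * x * poly (legendre_deriv n (Suc m)) x
      - (real n - real m) * (real n + real (Suc m)) * poly (legendre_deriv n m) x"
proof -
  have d: "legendre_deriv n j = Polynomial.smult (1 / (2 ^ n * fact n)) ((pderiv ^^ (n + j)) ([:-1, 0, 1:] ^ n))" for j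
    unfolding legendre_deriv_def legendre_poly_def pderiv_funpow_smult
    by (simp add: add.commute[of n] funpow_add)
  have "(1 - x\<^sup>2) * a2 = 2 * real (Suc m) * x * a1 - (real n - real m) * (real n + real (Suc m)) * a0"
    if "(x\<^sup>2 - 1) * a2 = (2 * real n - 2 * real (Suc (n + m))) * x * a1
      + real (Suc (n + m)) * (2 * real n - real (n + m)) * a0" for a0 a1 a2
    using that by (simp add: algebra_simps)
  from this[OF pderiv_funpow_quadratic_power[where x = x and n = n and k = "n + m"]]
  have *: "(1 - x\<^sup>2) * poly ((pderiv ^^ Suc (Suc (n + m))) ([:-1, 0, 1:] ^ n)) x
     = 2 * real (Suc m) * x * poly ((pderiv ^^ Suc (n + m)) ([:-1, 0, 1:] ^ n)) x
      - (real n - real m) * (real n + real (Suc m)) * poly ((pderiv ^^ (n + m)) ([:-1, 0, 1:] ^ n)) x" .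
  have scale: "p * (K * a) = q * (K * b) - r * (K * c)" if "p * a = q * b - r * c" for K a b c p q r :: real
    using arg_cong[OF that, of "\<lambda>t. K * t"] by (simp add: algebra_simps)
  show ?thesis unfolding d add_Suc_right poly_smult by (rule scale[OF *])
qed

lemma degree_pderiv_funpow: "degree ((pderiv ^^ k) (p :: real poly)) = degree p - k"
  by (induction k) (simp_all add: degree_pderiv)

text \<open>The degree is \<open>2 n - n = n\<close>. The case \<open>m = n + 1\<close> closes the
  telescoping sum of the addition theorem.\<close>

lemma legendre_deriv_eq_0: "n < m \<Longrightarrow> legendre_deriv n m = 0"
proof -
  assume nm: "n < m"
  have "degree ([:-1, 0, 1::real:] ^ n) = 2 * n" by (simp add: degree_power_eq)
  then have "degree (legendre_deriv n n) = 0"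
    unfolding legendre_deriv_def legendre_poly_def pderiv_funpow_smult degree_smult_eq
    by (simp add: degree_pderiv_funpow)
  then have 0: "legendre_deriv n (Suc n) = 0" by (metis pderiv_eq_0_iff pderiv_legendre_deriv)
  obtain j where "m = j + Suc n" using nm by (metis add.commute less_iff_Suc_add add_Suc_right)
  then have "legendre_deriv n m = (pderiv ^^ j) (legendre_deriv n (Suc n))"
    by (simp only: legendre_deriv_def funpow_add o_apply)
  also have "\<dots> = 0" unfolding 0 by (induction j) auto
  finally show ?thesis .
qed

definition legendre_ratio :: "nat \<Rightarrow> nat \<Rightarrow> real" where
  "legendre_ratio n m = fact (n - m) / fact (n + m)"

text \<open>The factor is the coefficient in \<open>legendre_deriv_recurrence\<close>, so weighting
  by the ratio absorbs it. Both the telescoping and the equality of the norms rest on this.\<close>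

lemma legendre_ratio_Suc:
  assumes "m < n"
  shows "legendre_ratio n (Suc m) * ((real n - real m) * (real n + real (Suc m))) = legendre_ratio n m"
proof -
  have "n - m = Suc (n - Suc m)" using assms by simp
  then have "(fact (n - m) :: real) = (real n - real m) * fact (n - Suc m)"
    using assms by (simp only: fact_Suc) (simp add: of_nat_diff)
  moreover have "(fact (n + Suc m) :: real) = (real n + real (Suc m)) * fact (n + m)"
    by (simp add: algebra_simps)
  moreover have "F / (b * G) * (a * b) = a * F / G" if "b \<noteq> 0" for a b F G :: real
    using that by simp
  moreover have "real n + real (Suc m) \<noteq> 0" by simp
  ultimately show ?thesis unfolding legendre_ratio_def by metis
qed

text \<open>The derivative of the left-hand side telescopes: with \<open>u\<^sub>m\<close> the \<open>m\<close>-th derivative of the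
  Legendre polynomial, \<open>r\<^sub>m\<close> the factorial ratio and
  \<open>T\<^sub>m = r\<^sub>m (1 - x\<^sup>2)\<^sup>m u\<^sub>m u\<^sub>m\<^sub>+\<^sub>1\<close>, the \<open>m\<close>-th summand has derivative \<open>T\<^sub>m - T\<^sub>m\<^sub>-\<^sub>1\<close>.\<close>

lemma legendre_addition_diagonal:
  "(poly (legendre_poly n) x)\<^sup>2 + 2 * (\<Sum>m=1..n. legendre_ratio n m *
     ((1 - x\<^sup>2) ^ m * (poly (legendre_deriv n m) x)\<^sup>2)) = 1"
proof -
  let ?u = "\<lambda>m x. poly (legendre_deriv n m) x"
  let ?S = "\<lambda>x. (?u 0 x)\<^sup>2 + 2 * (\<Sum>m=1..n. legendre_ratio n m * ((1 - x\<^sup>2) ^ m * (?u m x)\<^sup>2))"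
  let ?T = "\<lambda>m x. legendre_ratio n m * ((1 - x\<^sup>2) ^ m * ?u m x * ?u (Suc m) x)"
  have du: "(?u m has_real_derivative ?u (Suc m) x) (at x)" for m x
    using poly_DERIV[of "legendre_deriv n m" x] by simp
  have dterm: "((\<lambda>x. legendre_ratio n m * ((1 - x\<^sup>2) ^ m * (?u m x)\<^sup>2))
      has_real_derivative (?T m x - ?T (m - 1) x)) (at x)" if m_in: "m \<in> {1..n}" for m x
  proof -
    obtain k where m: "m = Suc k" and k: "k < n" using m_in by (cases m) auto
    have "((\<lambda>x. (1 - x\<^sup>2) ^ m) has_real_derivative real m * (- 2 * x * (1 - x\<^sup>2) ^ (m - Suc 0))) (at x)"
      by (intro DERIV_power) (auto intro!: derivative_eq_intros)
    then have dw: "((\<lambda>x. (1 - x\<^sup>2) ^ m) has_real_derivative real m * (1 - x\<^sup>2) ^ k * (- 2 * x)) (at x)"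
      by (simp add: m mult_ac)
    have "((\<lambda>x. legendre_ratio n m * ((1 - x\<^sup>2) ^ m * (?u m x)\<^sup>2)) has_real_derivative
       legendre_ratio n m * (real m * (1 - x\<^sup>2) ^ k * (- 2 * x) * (?u m x)\<^sup>2
         + (1 - x\<^sup>2) ^ m * (2 * ?u m x * ?u (Suc m) x))) (at x)"
      by (rule derivative_eq_intros dw du refl | simp)+
    also have "real m * (1 - x\<^sup>2) ^ k * (- 2 * x) * (?u m x)\<^sup>2 + (1 - x\<^sup>2) ^ m * (2 * ?u m x * ?u (Suc m) x)
       = (1 - x\<^sup>2) ^ m * ?u m x * ?u (Suc m) x
         - (real n - real k) * (real n + real (Suc k)) * ((1 - x\<^sup>2) ^ k * ?u k x * ?u (Suc k) x)"
    proof -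
      \<comment> \<open>The recurrence is inserted for one of the two copies of
        \<open>v * b\<close>; its term \<open>2 m x a\<close> cancels the derivative of the
        weight.\<close>
      have alg: "real m * w * (- 2 * x) * a\<^sup>2 + v * w * (2 * a * b) = v * w * a * b - C * (w * c * a)"
        if "v * b = 2 * real m * x * a - C * c" for v w a b c C :: real
      proof -
        have "v * w * (2 * a * b) = v * w * a * b + w * a * (v * b)" by (simp add: algebra_simps)
        then show ?thesis unfolding that by (simp add: algebra_simps power2_eq_square)
      qed
      show ?thesis
        using alg[OF legendre_deriv_recurrence[of x n k, folded m], of "(1 - x\<^sup>2) ^ k"] unfolding m by simp
    qed
    also have "legendre_ratio n m * \<dots> = ?T m x - ?T (m - 1) x"
      using legendre_ratio_Suc[OF k] unfolding m
      by (simp only: diff_Suc_1 right_diff_distrib mult.assoc[symmetric])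
    finally show ?thesis .
  qed
  have "(?S has_real_derivative 0) (at x)" for x
  proof -
    have "(?S has_real_derivative 2 * ?u 0 x * ?u 1 x + 2 * (\<Sum>m=1..n. ?T m x - ?T (m - 1) x)) (at x)"
    proof -
      have "((\<lambda>x. (?u 0 x)\<^sup>2) has_real_derivative 2 * ?u 0 x * ?u 1 x) (at x)"
        using DERIV_power[OF du[of 0 x], of 2] by (simp add: mult_ac)
      then show ?thesis by (intro DERIV_add DERIV_cmult DERIV_sum dterm)
    qed
    \<comment> \<open>The ratio in \<open>?T 0\<close> is 1, so the remaining
      \<open>- 2 * ?T 0 x\<close> cancels the derivative of the squared Legendre polynomial.\<close>
    also have "(\<Sum>m=1..n. ?T m x - ?T (m - 1) x) = ?T n x - ?T 0 x"
      using sum_telescope''[of 0 n "\<lambda>m. ?T m x"] by (simp add: atLeastSucAtMost_greaterThanAtMost)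
    also have "?T n x = 0" by (simp add: legendre_deriv_eq_0)
    finally show ?thesis by (simp add: legendre_ratio_def)
  qed
  then have "\<forall>x. (?S has_real_derivative 0) (at x)" by blast
  \<comment> \<open>At 1 the weights annihilate every term with \<open>m \<ge> 1\<close>, and the
    Legendre polynomial itself has value 1.\<close>
  from DERIV_isconst_all[OF this, of x 1] have "?S x = ?S 1" .
  also have "(\<Sum>m=1..n. legendre_ratio n m * ((1 - 1\<^sup>2) ^ m * (?u m 1)\<^sup>2)) = 0"
    by (rule sum.neutral) auto
  also have "(?u 0 1)\<^sup>2 + 2 * 0 = 1" by (simp add: legendre_poly_at_1)
  finally show ?thesis unfolding legendre_deriv_0 .
qed

section \<open>Integrals of Legendre functions over the polar angle\<close>

definition cos_integral :: "real poly \<Rightarrow> real" where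
  "cos_integral F = integral {0..pi} (\<lambda>t. sin t * poly F (cos t))"

lemma cos_integral_add: "cos_integral (F + G) = cos_integral F + cos_integral G"
proof -
  have "(\<lambda>t. sin t * poly F (cos t)) integrable_on {0..pi}" for F
    by (intro integrable_continuous_real continuous_intros)
  then show ?thesis
    unfolding cos_integral_def poly_add ring_distribs by (intro integral_add)
qed

lemma cos_integral_smult: "cos_integral (Polynomial.smult c F) = c * cos_integral F"
  unfolding cos_integral_def by (simp add: mult.left_commute)

lemma cos_integral_sum: "cos_integral (\<Sum>i\<in>I. F i) = (\<Sum>i\<in>I. cos_integral (F i))"
proof (induction I rule: infinite_finite_induct)
  case (insert i I)
  then show ?case by (simp add: cos_integral_add)
qed (simp_all add: cos_integral_def)

text \<open>An antiderivative is \<open>- F (cos t)\<close>. Under \<open>x = cos t\<close> the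
  functional is the integral of \<open>F\<close> over [-1, 1]; the angular form is the one that
  occurs in the uniform measure.\<close>

lemma cos_integral_pderiv: "cos_integral (pderiv F) = poly F 1 - poly F (-1)"
proof -
  have "((\<lambda>t. sin t * poly (pderiv F) (cos t)) has_integral (- poly F (cos pi) - (- poly F (cos 0)))) {0..pi}"
  proof (rule fundamental_theorem_of_calculus)
    fix t :: real
    have "((\<lambda>t. - poly F (cos t)) has_real_derivative sin t * poly (pderiv F) (cos t)) (at t within {0..pi})"
      by (auto intro!: derivative_eq_intros DERIV_chain2[OF poly_DERIV])
    then show "((\<lambda>t. - poly F (cos t)) has_vector_derivative sin t * poly (pderiv F) (cos t)) (at t within {0..pi})"
      by (simp add: has_real_derivative_iff_has_vector_derivative)
  qed simp
  then show ?thesis unfolding cos_integral_def by (simp add: integral_unique)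
qed

text \<open>The inner product of two associated Legendre functions of common order \<open>m\<close>:
  the signs and square roots pair up, which leaves a polynomial integrand.\<close>

definition legendre_inner :: "nat \<Rightarrow> nat \<Rightarrow> nat \<Rightarrow> real" where
  "legendre_inner m n n' = cos_integral ([:1, 0, -1:] ^ m * (legendre_deriv n m * legendre_deriv n' m))"

lemma legendre_inner_commute: "legendre_inner m n n' = legendre_inner m n' n"
  by (simp add: legendre_inner_def mult.commute)

text \<open>Integration by parts. The boundary term \<open>G\<close> carries the factor
  \<open>(1 - x^2)^(m+1)\<close> and vanishes at both ends, and the recurrence reduces the
  derivative of \<open>(1 - x^2)^(m+1)\<close> times \<open>legendre_deriv n (Suc m)\<close> to
  order \<open>m\<close>.\<close>

lemma legendre_inner_Suc:
  "legendre_inner (Suc m) n n' = (real n - real m) * (real n + real (Suc m)) * legendre_inner m n n'"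
proof -
  let ?w = "[:1, 0, -1::real:]"
  let ?c = "(real n - real m) * (real n + real (Suc m))"
  define G where "G = ?w ^ Suc m * (legendre_deriv n (Suc m) * legendre_deriv n' m)"
  have "poly (?w ^ Suc m * (legendre_deriv n (Suc m) * legendre_deriv n' (Suc m))) x
    = poly (pderiv G + Polynomial.smult ?c (?w ^ m * (legendre_deriv n m * legendre_deriv n' m))) x" for x
  proof -
    have w: "poly ?w x = 1 - x\<^sup>2" by (simp add: power2_eq_square)
    have dw: "poly (pderiv ?w) x = - 2 * x" by (simp add: pderiv_pCons)
    have alg: "W * v * (b * b') = W * v * (a2 * a1' + b * b') + b * a1' * (M * (W * (- 2 * x))) + C * (W * (a0 * a1'))"
      if "v * a2 = 2 * M * x * b - C * a0" for v W a0 b a2 a1' b' M C :: real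
    proof -
      have "W * v * (a2 * a1' + b * b') = W * a1' * (v * a2) + W * v * (b * b')" by (simp add: algebra_simps)
      then show ?thesis unfolding that by (simp add: algebra_simps)
    qed
    show ?thesis
      unfolding G_def pderiv_mult pderiv_power_Suc pderiv_legendre_deriv
      unfolding poly_add poly_mult poly_smult poly_power power_Suc2 w dw
      using alg[OF legendre_deriv_recurrence[of x n m], of "(1 - x\<^sup>2) ^ m" "poly (legendre_deriv n' (Suc m)) x"
         "poly (legendre_deriv n' m) x"] by (simp add: algebra_simps)
  qed
  then have "?w ^ Suc m * (legendre_deriv n (Suc m) * legendre_deriv n' (Suc m))
    = pderiv G + Polynomial.smult ?c (?w ^ m * (legendre_deriv n m * legendre_deriv n' m))"
    by (rule real_poly_ext)
  then have "legendre_inner (Suc m) n n' = cos_integral (pderiv G) + ?c * legendre_inner m n n'"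
    unfolding legendre_inner_def by (simp only: cos_integral_add cos_integral_smult)
  also have "cos_integral (pderiv G) = 0" unfolding cos_integral_pderiv by (simp add: G_def)
  finally show ?thesis by simp
qed

text \<open>For \<open>m = 0\<close> the symmetric quantity \<open>legendre_inner 1 n n'\<close> is
  evaluated from either side, with eigenvalue \<open>n (n + 1)\<close> or
  \<open>n' (n' + 1)\<close>; these differ. Higher orders inherit the zero from the
  recursion.\<close>

lemma legendre_inner_neq:
  assumes "n \<noteq> n'"
  shows "legendre_inner m n n' = 0"
proof (induction m)
  case 0
  have "real n * (real n + 1) * legendre_inner 0 n n' = real n' * (real n' + 1) * legendre_inner 0 n n'"
    using legendre_inner_Suc[of 0 n n'] legendre_inner_Suc[of 0 n' n]
    by (simp add: legendre_inner_commute[of _ n' n])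
  then have "((real n - real n') * (real n + real n' + 1)) * legendre_inner 0 n n' = 0"
    by (simp add: algebra_simps)
  moreover have "real n + real n' + 1 \<noteq> 0" by linarith
  ultimately show ?case using assms by simp
qed (simp add: legendre_inner_Suc)

lemma legendre_inner_ratio:
  "m \<le> n \<Longrightarrow> legendre_ratio n m * legendre_inner m n n = legendre_inner 0 n n"
proof (induction m)
  case (Suc m)
  then show ?case using legendre_ratio_Suc[of m n]
    by (simp only: legendre_inner_Suc mult.assoc[symmetric])
qed (simp add: legendre_ratio_def)

text \<open>The norm comes from integrating the addition theorem, all of whose \<open>2n + 1\<close> terms have the
  same integral.\<close>

lemma legendre_inner_self:
  assumes "m \<le> n"
  shows "legendre_ratio n m * legendre_inner m n n = 2 / (2 * real n + 1)"
proof -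
  let ?w = "[:1, 0, -1::real:]"
  have "poly (legendre_poly n * legendre_poly n + Polynomial.smult 2 (\<Sum>m=1..n. Polynomial.smult (legendre_ratio n m)
     (?w ^ m * (legendre_deriv n m * legendre_deriv n m)))) x = poly 1 x" for x
    using legendre_addition_diagonal[of n x] by (simp add: poly_sum power2_eq_square)
  then have eq: "legendre_poly n * legendre_poly n + Polynomial.smult 2 (\<Sum>m=1..n. Polynomial.smult (legendre_ratio n m)
     (?w ^ m * (legendre_deriv n m * legendre_deriv n m))) = 1"
    by (rule real_poly_ext)
  have "cos_integral 1 = 2" using cos_integral_pderiv[of "[:0, 1:]"] by (simp add: pderiv_pCons one_pCons)
  also have "cos_integral 1 = legendre_inner 0 n n + 2 * (\<Sum>m=1..n. legendre_ratio n m * legendre_inner m n n)"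
    unfolding eq[symmetric] cos_integral_add cos_integral_smult cos_integral_sum by (simp add: legendre_inner_def)
  also have "(\<Sum>m=1..n. legendre_ratio n m * legendre_inner m n n) = real n * legendre_inner 0 n n"
    by (simp add: legendre_inner_ratio)
  finally have "(2 * real n + 1) * legendre_inner 0 n n = 2" by (simp add: algebra_simps)
  then show ?thesis using legendre_inner_ratio[OF assms] by (simp add: field_simps)
qed

section \<open>Spherical harmonics\<close>

lemma sphere_dom_borel [measurable, simp]: "sphere_dom \<in> sets borel"
proof -
  have "{0..pi} \<times> {-pi<..pi} \<in> sets (borel \<Otimes>\<^sub>M borel)" by (intro pair_measureI) auto
  then show ?thesis unfolding sphere_dom_def borel_prod .
qed

lemma sets_xi_unif: "sets xi_unif = sets (restrict_space borel sphere_dom)"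
  unfolding xi_unif_def by (simp cong: sets_restrict_space_cong)

lemma xi_unif_integral:
  assumes f: "f \<in> borel_measurable borel"
  shows "integral\<^sup>L xi_unif f = (LINT x:sphere_dom|lborel. sin (fst x) / (4 * pi) * f x)"
proof -
  have xi: "xi_unif = density (restrict_space lborel sphere_dom) (\<lambda>x. ennreal (sin (fst x) / (4 * pi)))"
    unfolding xi_unif_def by (simp add: case_prod_unfold)
  have c: "(\<lambda>x::real \<times> real. sin (fst x) / (4 * pi)) \<in> borel_measurable borel"
    by (intro borel_measurable_continuous_onI continuous_intros) simp
  have "integral\<^sup>L xi_unif f = (LINT x|restrict_space lborel sphere_dom. (sin (fst x) / (4 * pi)) *\<^sub>R f x)"
    unfolding xi
  proof (rule integral_density)
    show "f \<in> borel_measurable (restrict_space lborel sphere_dom)"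
      using f by (intro measurable_restrict_space1) simp
    show "(\<lambda>x. sin (fst x) / (4 * pi)) \<in> borel_measurable (restrict_space lborel sphere_dom)"
      using c by (intro measurable_restrict_space1) simp
    \<comment> \<open>\<open>ennreal\<close> truncates negative values to 0, so the density agrees
      with the formula only because the sine is nonnegative on [0, pi].\<close>
    show "AE x in restrict_space lborel sphere_dom. 0 \<le> sin (fst x) / (4 * pi)"
      by (rule AE_I2) (auto simp: space_restrict_space sphere_dom_def sin_ge_zero)
  qed
  also have "\<dots> = (LINT x|lborel. indicator sphere_dom x *\<^sub>R ((sin (fst x) / (4 * pi)) *\<^sub>R f x))"
    by (rule integral_restrict_space) simp
  finally show ?thesis unfolding set_lebesgue_integral_def by simp
qed

lemma xi_unif_integral_product:
  assumes g: "continuous_on UNIV g" and h: "continuous_on UNIV (h :: real \<Rightarrow> real)"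
  shows "integral\<^sup>L xi_unif (\<lambda>x. g (fst x) * h (snd x))
    = integral {0..pi} (\<lambda>t. sin t * g t) * integral {-pi..pi} h / (4 * pi)"
proof -
  have cg: "continuous_on S (\<lambda>x. g (f x))" if "continuous_on S f" for S :: "'a::topological_space set" and f
    using continuous_on_compose2[OF g that] by simp
  have ch: "continuous_on S (\<lambda>x. h (f x))" if "continuous_on S f" for S :: "'a::topological_space set" and f
    using continuous_on_compose2[OF h that] by simp
  let ?f = "\<lambda>x. sin (fst x) / (4 * pi) * (g (fst x) * h (snd x))"
  let ?G = "\<lambda>t. indicator {0..pi} t * (sin t * g t / (4 * pi))"
  let ?H = "\<lambda>t. indicator {-pi<..pi} t * h t"
  \<comment> \<open>\<open>sphere_dom\<close> is not compact, being open at \<open>-pi\<close>;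
    integrability comes from continuity on the closed box.\<close>
  have "set_integrable lborel ({0..pi} \<times> {-pi..pi}) ?f"
    unfolding set_integrable_def
    by (intro borel_integrable_compact compact_Times compact_Icc continuous_intros cg ch) auto
  then have "set_integrable lborel sphere_dom ?f"
    by (rule set_integrable_subset) (auto simp: sphere_dom_def[symmetric], auto simp: sphere_dom_def)
  moreover have "(\<lambda>x. indicator sphere_dom x *\<^sub>R ?f x) = (\<lambda>x. ?G (fst x) * ?H (snd x))"
    by (auto simp: sphere_dom_def indicator_def fun_eq_iff)
  ultimately have int: "integrable (lborel \<Otimes>\<^sub>M lborel) (\<lambda>x. ?G (fst x) * ?H (snd x))"
    and eq: "set_lebesgue_integral lborel sphere_dom ?f = (LINT x|lborel. ?G (fst x) * ?H (snd x))"
    unfolding set_integrable_def set_lebesgue_integral_def lborel_prod by simp_all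
  have "(LINT x|lborel. ?G (fst x) * ?H (snd x)) = (LBINT t. LBINT u. ?G t * ?H u)"
    using lborel_pair.integral_fst'[OF int] by (simp add: lborel_prod)
  also have "\<dots> = (LBINT t. ?G t) * (LBINT u. ?H u)" by simp
  also have "(LBINT t. ?G t) = (LINT t:{0..pi}|lborel. sin t * g t / (4 * pi))"
    by (simp add: set_lebesgue_integral_def)
  also have "\<dots> = integral {0..pi} (\<lambda>t. sin t * g t / (4 * pi))"
  proof (intro set_borel_integral_eq_integral)
    show "set_integrable lborel {0..pi} (\<lambda>t. sin t * g t / (4 * pi))"
      unfolding set_integrable_def by (intro borel_integrable_compact compact_Icc continuous_intros cg) auto
  qed
  also have "(LBINT u. ?H u) = (LINT u:{-pi<..pi}|lborel. h u)"
    by (simp add: set_lebesgue_integral_def)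
  also have "\<dots> = integral {-pi<..pi} h"
  proof (intro set_borel_integral_eq_integral)
    have "set_integrable lborel {-pi..pi} h"
      unfolding set_integrable_def by (intro borel_integrable_compact ch continuous_intros) auto
    then show "set_integrable lborel {-pi<..pi} h" by (rule set_integrable_subset) auto
  qed
  also have "\<dots> = integral {-pi..pi} h"
  proof (rule integral_spike_set)
    have "{x \<in> {-pi..pi} - {-pi<..pi}. h x \<noteq> 0} \<subseteq> {-pi}" by auto
    then show "negligible {x \<in> {-pi..pi} - {-pi<..pi}. h x \<noteq> 0}" by (rule negligible_subset[rotated]) simp
    have "{x \<in> {-pi<..pi} - {-pi..pi}. h x \<noteq> 0} = {}" by auto
    then show "negligible {x \<in> {-pi<..pi} - {-pi..pi}. h x \<noteq> 0}" by (simp only: negligible_empty)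
  qed
  finally show ?thesis
    using xi_unif_integral[of "\<lambda>x. g (fst x) * h (snd x)"] eq
    by (simp add: borel_measurable_continuous_onI continuous_on_mult cg ch continuous_on_fst continuous_on_snd continuous_on_id)
qed

section \<open>Separation into polar and azimuthal factors\<close>

lemma has_integral_cos_int:
  "((\<lambda>t. cos (of_int k * t)) has_integral (if k = 0 then 2 * pi else 0)) {-pi..pi}"
proof (cases "k = 0")
  case True
  then show ?thesis using has_integral_const_real[of "1::real" "-pi" pi] by simp
next
  case False
  have "((\<lambda>t. cos (of_int k * t)) has_integral (sin (of_int k * pi) / of_int k - sin (of_int k * (-pi)) / of_int k)) {-pi..pi}"
  proof (rule fundamental_theorem_of_calculus)
    fix t :: real
    have "((\<lambda>t. sin (of_int k * t) / of_int k) has_real_derivative cos (of_int k * t)) (at t within {-pi..pi})"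
      using False by (auto intro!: derivative_eq_intros)
    then show "((\<lambda>t. sin (of_int k * t) / of_int k) has_vector_derivative cos (of_int k * t)) (at t within {-pi..pi})"
      by (simp add: has_real_derivative_iff_has_vector_derivative)
  qed simp
  then show ?thesis using False by (simp add: mult.commute[of _ pi] sin_int_times_real)
qed

lemma has_integral_sin_int: "((\<lambda>t. sin (of_int k * t)) has_integral 0) {-pi..pi}"
proof (cases "k = 0")
  case False
  have "((\<lambda>t. sin (of_int k * t)) has_integral (- cos (of_int k * pi) / of_int k - (- cos (of_int k * (-pi)) / of_int k))) {-pi..pi}"
  proof (rule fundamental_theorem_of_calculus)
    fix t :: real
    have "((\<lambda>t. - cos (of_int k * t) / of_int k) has_real_derivative sin (of_int k * t)) (at t within {-pi..pi})"
      using False by (auto intro!: derivative_eq_intros)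
    then show "((\<lambda>t. - cos (of_int k * t) / of_int k) has_vector_derivative sin (of_int k * t)) (at t within {-pi..pi})"
      by (simp add: has_real_derivative_iff_has_vector_derivative)
  qed simp
  then show ?thesis by simp
qed (simp)

definition azimuthal :: "int \<Rightarrow> real \<Rightarrow> real" where
  "azimuthal m t = (if m = 0 then 1 else if m > 0 then cos (of_int m * t) else sin (of_int (- m) * t))"

lemma continuous_on_azimuthal: "continuous_on S (azimuthal m)"
  unfolding azimuthal_def by (cases "m = 0"; cases "m > 0") (auto intro!: continuous_intros)

text \<open>Product-to-sum formulas reduce everything to frequencies \<open>a - b\<close> and
  \<open>a + b\<close>. Both vanish only for \<open>m = m' = 0\<close>, whence 2 pi there and pi for
  other equal orders.\<close>

lemma integral_azimuthal:
  "integral {-pi..pi} (\<lambda>t. azimuthal m t * azimuthal m' t)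
    = (if m = m' then (if m = 0 then 2 * pi else pi) else 0)"
proof -
  have cc: "((\<lambda>t. cos (of_int a * t) * cos (of_int b * t)) has_integral
     ((if a - b = 0 then 2 * pi else 0) + (if a + b = 0 then 2 * pi else 0)) / 2) {-pi..pi}" for a b
    using has_integral_divide[OF has_integral_add[OF has_integral_cos_int[of "a - b"] has_integral_cos_int[of "a + b"]], of 2]
    by (simp add: cos_times_cos ring_distribs)
  have ss: "((\<lambda>t. sin (of_int a * t) * sin (of_int b * t)) has_integral
     ((if a - b = 0 then 2 * pi else 0) - (if a + b = 0 then 2 * pi else 0)) / 2) {-pi..pi}" for a b
    using has_integral_divide[OF has_integral_diff[OF has_integral_cos_int[of "a - b"] has_integral_cos_int[of "a + b"]], of 2]
    by (simp add: sin_times_sin ring_distribs)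
  have sc: "((\<lambda>t. sin (of_int a * t) * cos (of_int b * t)) has_integral 0) {-pi..pi}" for a b
    using has_integral_divide[OF has_integral_add[OF has_integral_sin_int[of "a + b"] has_integral_sin_int[of "a - b"]], of 2]
    by (simp add: sin_times_cos ring_distribs)
  have cs: "((\<lambda>t. cos (of_int b * t) * sin (of_int a * t)) has_integral 0) {-pi..pi}" for a b
    using sc[of a b] by (simp add: mult.commute)
  \<comment> \<open>Order 0 joins the cosine family because \<open>cos 0 = 1\<close>, which leaves
    four sign cases.\<close>
  have az: "azimuthal k = (if k \<ge> 0 then (\<lambda>t. cos (of_int k * t)) else (\<lambda>t. sin (of_int (- k) * t)))" for k
    by (auto simp: azimuthal_def fun_eq_iff)
  consider "m \<ge> 0" "m' \<ge> 0" | "m \<ge> 0" "m' < 0" | "m < 0" "m' \<ge> 0" | "m < 0" "m' < 0" by linarith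
  then show ?thesis
  proof cases
    case 1
    then show ?thesis unfolding az using cc[of m m'] by (auto dest!: integral_unique)
  next
    case 2
    then show ?thesis unfolding az using cs[of m "- m'"] by (auto dest!: integral_unique)
  next
    case 3
    then show ?thesis unfolding az using sc[of "- m" m'] by (auto dest!: integral_unique)
  next
    case 4
    then show ?thesis unfolding az using ss[of "- m" "- m'"] by (auto dest!: integral_unique)
  qed
qed

text \<open>The whole normalizing constant is kept in the polar factor. Its 1 or 2 compensates for
  the squared azimuthal factor having integral 2 pi for \<open>k = 0\<close> and pi
  otherwise.\<close>

definition polar_part :: "nat \<Rightarrow> nat \<Rightarrow> real \<Rightarrow> real" where
  "polar_part n k t = sqrt ((if k = 0 then 1 else 2) * (2 * real n + 1) * legendre_ratio n k)
     * assoc_legendre n k (cos t)"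

lemma sph_harm_eq: "sph_harm n m x = polar_part n (nat \<bar>m\<bar>) (fst x) * azimuthal m (snd x)"
  by (cases x)
     (auto simp: sph_harm_def polar_part_def azimuthal_def legendre_ratio_def assoc_legendre_def)

lemma continuous_on_polar_part: "continuous_on S (polar_part n k)"
  unfolding polar_part_def assoc_legendre_def by (intro continuous_intros)

lemma continuous_on_sph_harm: "continuous_on S (sph_harm n m)"
proof -
  have "continuous_on S (\<lambda>x. polar_part n (nat \<bar>m\<bar>) (fst x) * azimuthal m (snd x))"
    by (intro continuous_intros continuous_on_compose2[OF continuous_on_polar_part[of UNIV]]
          continuous_on_compose2[OF continuous_on_azimuthal[of UNIV]]) auto
  then show ?thesis by (simp add: sph_harm_eq[abs_def])
qed

lemma legendre_ratio_pos: "legendre_ratio n k > 0"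
  by (simp add: legendre_ratio_def)

lemma polar_part_mult:
  "polar_part n k t * polar_part n' k t =
    sqrt ((if k = 0 then 1 else 2) * (2 * real n + 1) * legendre_ratio n k)
    * sqrt ((if k = 0 then 1 else 2) * (2 * real n' + 1) * legendre_ratio n' k)
    * poly ([:1, 0, -1:] ^ k * (legendre_deriv n k * legendre_deriv n' k)) (cos t)"
proof -
  have nn: "1 - (cos t)\<^sup>2 \<ge> 0" by (simp add: sin_squared_eq[symmetric])
  have "((-1) ^ k * (-1) ^ k :: real) = 1" by (simp add: power_mult_distrib[symmetric])
  moreover have "sqrt (1 - (cos t)\<^sup>2) ^ k * sqrt (1 - (cos t)\<^sup>2) ^ k = (1 - (cos t)\<^sup>2) ^ k"
    using nn by (simp add: power_mult_distrib[symmetric])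
  moreover have "poly ([:1, 0, -1:] ^ k) (cos t) = (1 - (cos t)\<^sup>2) ^ k" by (simp add: power2_eq_square)
  moreover have "c * (s * r * u) * (c' * (s * r * u')) = c * c' * (R * (u * u'))"
    if "s * s = 1" "r * r = R" for c c' s r u u' R :: real
  proof -
    have "c * (s * r * u) * (c' * (s * r * u')) = (s * s) * (r * r) * c * c' * u * u'" by (simp add: mult_ac)
    then show ?thesis unfolding that by (simp add: mult_ac)
  qed
  ultimately show ?thesis
    unfolding polar_part_def assoc_legendre_def legendre_deriv_def[symmetric] poly_mult by presburger
qed

lemma sph_harm_orthonormal:
  assumes "\<bar>m\<bar> \<le> int n" "\<bar>m'\<bar> \<le> int n'"
  shows "integral\<^sup>L xi_unif (\<lambda>x. sph_harm n m x * sph_harm n' m' x) = (if n = n' \<and> m = m' then 1 else 0)"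
proof -
  let ?g = "\<lambda>t. polar_part n (nat \<bar>m\<bar>) t * polar_part n' (nat \<bar>m'\<bar>) t"
  let ?h = "\<lambda>t. azimuthal m t * azimuthal m' t"
  have "integral\<^sup>L xi_unif (\<lambda>x. sph_harm n m x * sph_harm n' m' x)
    = integral\<^sup>L xi_unif (\<lambda>x. ?g (fst x) * ?h (snd x))"
    by (simp add: sph_harm_eq mult_ac)
  also have "\<dots> = integral {0..pi} (\<lambda>t. sin t * ?g t) * integral {-pi..pi} ?h / (4 * pi)"
    by (intro xi_unif_integral_product continuous_on_mult continuous_on_polar_part continuous_on_azimuthal)
  also have "\<dots> = (if n = n' \<and> m = m' then 1 else 0)"
  proof (cases "m = m'")
    case True
    define k where "k = nat \<bar>m\<bar>"
    have k: "k \<le> n" using assms by (simp add: k_def)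
    let ?c = "\<lambda>n. (if k = 0 then 1 else 2) * (2 * real n + 1) * legendre_ratio n k"
    have "integral {0..pi} (\<lambda>t. sin t * ?g t) = sqrt (?c n) * sqrt (?c n') * legendre_inner k n n'"
      unfolding True[symmetric] k_def[symmetric] polar_part_mult legendre_inner_def cos_integral_def
      by (simp only: mult.left_commute[of "sin _"] mult.assoc integral_mult_right)
    \<comment> \<open>Multiplied by the azimuthal integral this is \<open>2 * 2 pi\<close> or
      \<open>4 * pi\<close>, in both cases the total \<open>4 pi\<close> that the density divides
      out.\<close>
    also have "\<dots> = (if n = n' then (if k = 0 then 2 else 4) else 0)"
    proof (cases "n = n'")
      case True
      have "?c n \<ge> 0" using legendre_ratio_pos[of n k] by simp
      then have "sqrt (?c n) * sqrt (?c n) = ?c n" by (rule real_sqrt_mult_self[THEN trans, OF abs_of_nonneg])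
      then have "sqrt (?c n) * sqrt (?c n') * legendre_inner k n n'
        = (if k = 0 then 1 else 2) * (2 * real n + 1) * (legendre_ratio n k * legendre_inner k n n)"
        unfolding True[symmetric] by (simp only: mult.assoc)
      also have "\<dots> = (if k = 0 then 1 else 2) * 2"
        unfolding legendre_inner_self[OF k] by simp
      finally show ?thesis using True by simp
    qed (simp add: legendre_inner_neq)
    finally show ?thesis using True by (auto simp: integral_azimuthal k_def)
  qed (simp add: integral_azimuthal)
  finally show ?thesis .
qed

lemma sum_symmetric_int_interval:
  fixes f :: "int \<Rightarrow> 'a::ab_group_add"
  shows "(\<Sum>m=-int n..int n. f m) = f 0 + (\<Sum>k=1..n. f (int k) + f (- int k))"
proof (induction n)
  case (Suc n)
  have "{- int (Suc n)..int (Suc n)} = insert (int (Suc n)) (insert (- int (Suc n)) {- int n..int n})"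
    by auto
  then have "(\<Sum>m=-int (Suc n)..int (Suc n). f m) = f (int (Suc n)) + (f (- int (Suc n)) + (\<Sum>m=-int n..int n. f m))"
    by simp
  then show ?case using Suc by (simp add: ac_simps)
qed simp

text \<open>Orders \<open>k\<close> and \<open>-k\<close> share the polar factor, so
  \<open>cos^2 + sin^2 = 1\<close> removes the longitude and leaves the Legendre identity at
  \<open>cos (fst x)\<close>.\<close>

lemma sum_sph_harm_square: "(\<Sum>m=-int n..int n. (sph_harm n m x)\<^sup>2) = 2 * real n + 1"
proof -
  define u where "u k = poly (legendre_deriv n k) (cos (fst x))" for k
  define w where "w = 1 - (cos (fst x))\<^sup>2"
  have pp: "(polar_part n k (fst x))\<^sup>2 = (if k = 0 then 1 else 2) * (2 * real n + 1) * legendre_ratio n k * (w ^ k * (u k)\<^sup>2)" for k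
    using legendre_ratio_pos[of n k]
    unfolding power2_eq_square polar_part_mult by (simp add: u_def w_def power2_eq_square)
  have "(sph_harm n (int k) x)\<^sup>2 + (sph_harm n (- int k) x)\<^sup>2
     = (2 * real n + 1) * (2 * (legendre_ratio n k * (w ^ k * (u k)\<^sup>2)))" if "k \<in> {1..n}" for k
  proof -
    have "k \<noteq> 0" using that by simp
    then have "(sph_harm n (int k) x)\<^sup>2 + (sph_harm n (- int k) x)\<^sup>2
      = (polar_part n k (fst x))\<^sup>2 * ((cos (real k * snd x))\<^sup>2 + (sin (real k * snd x))\<^sup>2)"
      unfolding sph_harm_eq by (simp add: azimuthal_def power_mult_distrib distrib_left[symmetric])
    also have "(cos (real k * snd x))\<^sup>2 + (sin (real k * snd x))\<^sup>2 = 1" by simp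
    finally show ?thesis using \<open>k \<noteq> 0\<close> by (simp add: pp)
  qed
  then have "(\<Sum>m=-int n..int n. (sph_harm n m x)\<^sup>2)
     = (sph_harm n 0 x)\<^sup>2 + (\<Sum>k=1..n. (2 * real n + 1) * (2 * (legendre_ratio n k * (w ^ k * (u k)\<^sup>2))))"
    unfolding sum_symmetric_int_interval by simp
  also have "(sph_harm n 0 x)\<^sup>2 = (2 * real n + 1) * (u 0)\<^sup>2"
    using pp[of 0] unfolding sph_harm_eq by (simp add: azimuthal_def legendre_ratio_def)
  also have "(2 * real n + 1) * (u 0)\<^sup>2 + (\<Sum>k=1..n. (2 * real n + 1) * (2 * (legendre_ratio n k * (w ^ k * (u k)\<^sup>2))))
    = (2 * real n + 1) * ((u 0)\<^sup>2 + 2 * (\<Sum>k=1..n. legendre_ratio n k * (w ^ k * (u k)\<^sup>2)))"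
    by (simp add: sum_distrib_left ring_distribs mult_ac)
  also have "\<dots> = 2 * real n + 1"
    using legendre_addition_diagonal[of n "cos (fst x)"] by (simp add: u_def w_def)
  finally show ?thesis .
qed

section \<open>Linear indexing by degree and order\<close>

lemma sh_deg_eq: "i \<in> {k\<^sup>2..<(k + 1)\<^sup>2} \<Longrightarrow> sh_deg i = k"
  unfolding sh_deg_def by (rule floor_sqrt_unique) auto

lemma sh_deg_bounds: "(sh_deg i)\<^sup>2 \<le> i" "i < (sh_deg i + 1)\<^sup>2"
  unfolding sh_deg_def using Suc_floor_sqrt_power2_gt[of i] by auto

lemma abs_sh_ord_le: "\<bar>sh_ord i\<bar> \<le> int (sh_deg i)"
proof -
  have "int ((sh_deg i)\<^sup>2) \<le> int i" "int i < int ((sh_deg i + 1)\<^sup>2)"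
    using sh_deg_bounds[of i] by linarith+
  then show ?thesis unfolding sh_ord_def by (simp add: power2_eq_square algebra_simps)
qed

lemma sh_index_inj: "sh_deg i = sh_deg j \<Longrightarrow> sh_ord i = sh_ord j \<Longrightarrow> i = j"
  unfolding sh_ord_def by simp

text \<open>Within a degree block \<open>sh_ord\<close> is injective into the orders
  \<open>-k..k\<close>, and both sets have \<open>2 k + 1\<close> elements; surjectivity follows by
  counting.\<close>

lemma sum_sh_f_square: "(\<Sum>i\<in>{k\<^sup>2..<(k + 1)\<^sup>2}. (sh_f i x)\<^sup>2) = 2 * real k + 1"
proof -
  have "bij_betw sh_ord {k\<^sup>2..<(k + 1)\<^sup>2} {- int k..int k}"
    unfolding bij_betw_def
  proof
    show inj: "inj_on sh_ord {k\<^sup>2..<(k + 1)\<^sup>2}"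
      by (rule inj_onI) (metis sh_deg_eq sh_index_inj)
    have sub: "sh_ord ` {k\<^sup>2..<(k + 1)\<^sup>2} \<subseteq> {- int k..int k}"
    proof
      fix m assume "m \<in> sh_ord ` {k\<^sup>2..<(k + 1)\<^sup>2}"
      then obtain i where "m = sh_ord i" "sh_deg i = k" using sh_deg_eq by blast
      then show "m \<in> {- int k..int k}" using abs_sh_ord_le[of i] by auto
    qed
    have "card (sh_ord ` {k\<^sup>2..<(k + 1)\<^sup>2}) = card {- int k..int k}"
      unfolding card_image[OF inj] by (simp add: power2_eq_square nat_eq_iff)
    then show "sh_ord ` {k\<^sup>2..<(k + 1)\<^sup>2} = {- int k..int k}"
      using sub by (intro card_subset_eq) auto
  qed
  then have "(\<Sum>i\<in>{k\<^sup>2..<(k + 1)\<^sup>2}. (sph_harm k (sh_ord i) x)\<^sup>2) = (\<Sum>m=-int k..int k. (sph_harm k m x)\<^sup>2)"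
    by (rule sum.reindex_bij_betw)
  moreover have "sh_f i x = sph_harm k (sh_ord i) x" if "i \<in> {k\<^sup>2..<(k + 1)\<^sup>2}" for i
    unfolding sh_f_def sh_deg_eq[OF that] ..
  ultimately show ?thesis by (simp add: sum_sph_harm_square)
qed

lemma info_mat_xi_unif: "info_mat d xi_unif = 1\<^sub>m (sh_dim d)"
proof (rule eq_matI)
  fix i j assume "i < dim_row (1\<^sub>m (sh_dim d) :: real mat)" "j < dim_col (1\<^sub>m (sh_dim d) :: real mat)"
  then show "info_mat d xi_unif $$ (i, j) = 1\<^sub>m (sh_dim d) $$ (i, j)"
    unfolding info_mat_def sh_f_def
    using sph_harm_orthonormal[OF abs_sh_ord_le abs_sh_ord_le, of i j] sh_index_inj[of i j] by auto
qed (auto simp: info_mat_def)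

lemma continuous_on_sh_f: "continuous_on S (sh_f i)"
  unfolding sh_f_def[abs_def] by (simp add: continuous_on_sph_harm)

lemma sh_f_measurable: "sets M = sets (restrict_space borel sphere_dom) \<Longrightarrow> sh_f i \<in> borel_measurable M"
  using measurable_restrict_space1[OF borel_measurable_continuous_onI[OF continuous_on_sh_f[of UNIV i]], of sphere_dom]
  by (simp cong: measurable_cong_sets)

text \<open>One nonnegative summand of a constant sum. This uniform bound makes all information
  integrals exist under an arbitrary design.\<close>

lemma sh_f_square_le: "(sh_f i x)\<^sup>2 \<le> 2 * real (sh_deg i) + 1"
  unfolding sum_sh_f_square[where k = "sh_deg i" and x = x, symmetric]
  using sh_deg_bounds[of i] by (intro member_le_sum) auto

lemma design_xi_unif: "design xi_unif"
proof -
  have f0: "sh_f 0 x * sh_f 0 x = 1" for x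
    using sum_sh_f_square[where k = 0 and x = x] by (simp add: power2_eq_square)
  have 1: "integral\<^sup>L xi_unif (\<lambda>x. 1::real) = 1"
    using sph_harm_orthonormal[of 0 0 0 0] f0 unfolding sh_f_def sh_deg_def sh_ord_def by simp
  \<comment> \<open>The Bochner integral of a non-integrable function is 0 by convention, so the
    value 1, the squared norm of the degree 0 harmonic, proves integrability and hence total mass
    1.\<close>
  then have "integrable xi_unif (\<lambda>x. 1::real)" by (metis not_integrable_integral_eq zero_neq_one)
  then have "emeasure xi_unif (space xi_unif) = ennreal 1"
    using nn_integral_eq_integral[of xi_unif "\<lambda>x. 1"] 1 by simp
  then show ?thesis unfolding design_def by (auto intro!: prob_spaceI simp: sets_xi_unif)
qed

lemma design_integrable:
  assumes "design \<eta>"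
  shows "integrable \<eta> (\<lambda>x. sh_f i x * sh_f j x)"
proof -
  interpret prob_space \<eta> using assms by (simp add: design_def)
  have s: "sets \<eta> = sets (restrict_space borel sphere_dom)" using assms by (simp add: design_def)
  have "\<bar>sh_f i x * sh_f j x\<bar> \<le> (2 * real (sh_deg i) + 1) + (2 * real (sh_deg j) + 1)" for x
  proof -
    have "2 * \<bar>a * b\<bar> \<le> a\<^sup>2 + b\<^sup>2" for a b :: real
      using zero_le_power2[of "\<bar>a\<bar> - \<bar>b\<bar>"] by (simp add: power2_diff abs_mult)
    from this[of "sh_f i x" "sh_f j x"] show ?thesis using sh_f_square_le[of i x] sh_f_square_le[of j x] by linarith
  qed
  then show ?thesis
    by (intro integrable_const_bound[of _ "(2 * real (sh_deg i) + 1) + (2 * real (sh_deg j) + 1)"] borel_measurable_times sh_f_measurable[OF s])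
       auto
qed

section \<open>Real symmetric matrices\<close>

text \<open>The characteristic polynomial has a complex root \<open>z\<close> with eigenvector
  \<open>v\<close>. The form \<open>q = v^* A v\<close> is real by symmetry and equals
  \<open>z\<close> times the positive number \<open>r\<close>, so \<open>z\<close> is real and a
  root of the real characteristic polynomial.\<close>

lemma symmetric_mat_eigenvector:
  fixes A :: "real mat"
  assumes A: "A \<in> carrier_mat n n" and sym: "transpose_mat A = A" and n: "n > 0"
  obtains e v where "eigenvector A v e"
proof -
  let ?A = "map_mat complex_of_real A"
  have cA: "?A \<in> carrier_mat n n" using A by auto
  have "degree (char_poly ?A) = n" using degree_monic_char_poly[OF cA] by auto
  then have "\<not> constant (poly (char_poly ?A))" using n by (simp add: constant_degree)
  then obtain z where z: "poly (char_poly ?A) z = 0" using fundamental_theorem_of_algebra by blast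
  then have "eigenvalue ?A z" using eigenvalue_root_char_poly[OF cA] by simp
  then obtain v where v: "v \<in> carrier_vec n" and v0: "v \<noteq> 0\<^sub>v n" and ev: "?A *\<^sub>v v = z \<cdot>\<^sub>v v"
    unfolding eigenvalue_def eigenvector_def using A by auto
  have Ae: "(\<Sum>j<n. of_real (A $$ (i,j)) * v $ j) = z * v $ i" if "i < n" for i
  proof -
    have "(?A *\<^sub>v v) $ i = (\<Sum>j<n. of_real (A $$ (i,j)) * v $ j)"
      using that A v by (simp add: scalar_prod_def lessThan_atLeast0)
    then show ?thesis using ev that v by simp
  qed
  define q where "q = (\<Sum>i<n. \<Sum>j<n. cnj (v $ i) * of_real (A $$ (i,j)) * v $ j)"
  define r where "r = (\<Sum>i<n. (cmod (v $ i))\<^sup>2)"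
  have symA: "A $$ (i,j) = A $$ (j,i)" if "i < n" "j < n" for i j
    using sym A that by (metis carrier_matD index_transpose_mat(1))
  have "cnj q = (\<Sum>i<n. \<Sum>j<n. v $ i * of_real (A $$ (i,j)) * cnj (v $ j))"
    unfolding q_def by simp
  also have "\<dots> = (\<Sum>j<n. \<Sum>i<n. v $ i * of_real (A $$ (i,j)) * cnj (v $ j))"
    by (rule sum.swap)
  also have "\<dots> = q" unfolding q_def
    by (intro sum.cong refl) (auto simp: symA mult_ac)
  finally have "cnj q = q" .
  moreover have "q = z * of_real r"
  proof -
    have "q = (\<Sum>i<n. cnj (v $ i) * (\<Sum>j<n. of_real (A $$ (i,j)) * v $ j))"
      unfolding q_def by (simp add: sum_distrib_left mult_ac)
    also have "\<dots> = (\<Sum>i<n. cnj (v $ i) * (z * v $ i))" by (simp add: Ae)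
    also have "\<dots> = z * (\<Sum>i<n. v $ i * cnj (v $ i))" by (simp add: sum_distrib_left mult_ac)
    also have "(\<Sum>i<n. v $ i * cnj (v $ i)) = of_real r"
      unfolding r_def of_real_sum by (intro sum.cong refl) (simp only: complex_norm_square)
    finally show ?thesis .
  qed
  moreover have "r \<noteq> 0"
  proof
    assume "r = 0"
    then have "\<forall>i<n. v $ i = 0" unfolding r_def by (subst (asm) sum_nonneg_eq_0_iff) auto
    then have "v = 0\<^sub>v n" using v by (intro eq_vecI) auto
    with v0 show False by simp
  qed
  ultimately have "cnj z = z" by simp
  then have zr: "z = complex_of_real (Re z)" by (simp add: complex_eq_iff)
  interpret h: comm_ring_hom complex_of_real by standard auto
  have "poly (char_poly ?A) z = of_real (poly (char_poly A) (Re z))"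
    unfolding of_real_hom.char_poly_hom[OF A] by (subst zr) simp
  then have "poly (char_poly A) (Re z) = 0" using z by simp
  then have "eigenvalue A (Re z)" using eigenvalue_root_char_poly[OF A] by simp
  then show thesis using that unfolding eigenvalue_def by auto
qed

text \<open>Gram-Schmidt on a basis starting with \<open>v\<close> keeps \<open>v\<close> as its
  first vector; the scalar \<open>c\<close> comes from normalizing afterwards.\<close>

lemma orthogonal_mat_first_col:
  fixes v :: "real vec"
  assumes v: "v \<in> carrier_vec n" and v0: "v \<noteq> 0\<^sub>v n"
  obtains W c where "W \<in> carrier_mat n n" "transpose_mat W * W = 1\<^sub>m n" "c \<noteq> 0" "col W 0 = c \<cdot>\<^sub>v v"
proof -
  interpret cof_vec_space n "TYPE(real)" .
  have n: "n > 0" using v v0 by (cases n) auto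
  note b = basis_completion[OF v v0]
  obtain vs where bv: "basis_completion v = v # vs"
    using b(6,7) n by (cases "basis_completion v") auto
  define ws where "ws = gram_schmidt n (basis_completion v)"
  note g = gram_schmidt_result[OF b(2,4,5) ws_def]
  have len: "length ws = n" using g(4) b(6) by simp
  have hd: "hd ws = v" unfolding ws_def bv using gram_schmidt_hd[OF v] .
  have wsc: "ws ! i \<in> carrier_vec n" if "i < n" for i using g(3) len that by (metis nth_mem subset_eq)
  have orth: "(ws ! i \<bullet> ws ! j = 0) = (i \<noteq> j)" if "i < n" "j < n" for i j
    using corthogonalD[OF g(2), of i j] that len by simp
  define c where "c i = 1 / sqrt (ws ! i \<bullet> ws ! i)" for i
  have pos: "ws ! i \<bullet> ws ! i > 0" if "i < n" for i
  proof -
    have "ws ! i \<bullet> ws ! i \<ge> 0" unfolding scalar_prod_def by (intro sum_nonneg) auto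
    then show ?thesis using orth[OF that that] by simp
  qed
  define W where "W = mat_of_cols n (map (\<lambda>i. c i \<cdot>\<^sub>v ws ! i) [0..<n])"
  have W: "W \<in> carrier_mat n n" unfolding W_def using mat_of_cols_carrier(1)[of n "map (\<lambda>i. c i \<cdot>\<^sub>v ws ! i) [0..<n]"] by simp
  have colW: "col W i = c i \<cdot>\<^sub>v ws ! i" if "i < n" for i
    unfolding W_def using that wsc[OF that] by (subst col_mat_of_cols) auto
  have "transpose_mat W * W = 1\<^sub>m n"
  proof (rule eq_matI)
    fix i j assume ij: "i < dim_row (1\<^sub>m n)" "j < dim_col (1\<^sub>m n)"
    then have "(transpose_mat W * W) $$ (i,j) = col W i \<bullet> col W j" using W by simp
    also have "\<dots> = c i * c j * (ws ! i \<bullet> ws ! j)"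
      using ij wsc[of i] wsc[of j] by (simp add: colW)
    also have "\<dots> = 1\<^sub>m n $$ (i,j)"
      using ij orth[of i j] pos[of i] by (auto simp: c_def)
    finally show "(transpose_mat W * W) $$ (i,j) = 1\<^sub>m n $$ (i,j)" .
  qed (use W in auto)
  moreover have "col W 0 = c 0 \<cdot>\<^sub>v v" using colW[OF n] hd n len by (cases ws) auto
  moreover have "c 0 \<noteq> 0" using pos[OF n] by (simp add: c_def)
  ultimately show thesis using that W by blast
qed

lemma diag_of_carrier [simp]: "diag_of n l \<in> carrier_mat n n"
  by (simp add: diag_of_def)

text \<open>Deflation: if the first column of the orthogonal \<open>W\<close> is an eigenvector,
  then \<open>W^T A W\<close> has first column \<open>(e, 0, ..., 0)\<close>, by symmetry also such
  a first row, and the remaining block falls to the induction hypothesis.\<close>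

lemma real_spectral_theorem:
  assumes "A \<in> carrier_mat n n" and "transpose_mat A = A"
  shows "\<exists>U l. U \<in> carrier_mat n n \<and> transpose_mat U * U = 1\<^sub>m n
           \<and> A = U * diag_of n l * transpose_mat U"
  using assms
proof (induction n arbitrary: A)
  case 0
  then show ?case by (intro exI[of _ "1\<^sub>m 0"] exI[of _ "\<lambda>_. 0"]) auto
next
  case (Suc m)
  note A = Suc.prems(1) and sym = Suc.prems(2)
  let ?n = "Suc m"
  obtain e v where ev: "eigenvector A v e"
    using symmetric_mat_eigenvector[OF A sym] by blast
  then have v: "v \<in> carrier_vec ?n" "v \<noteq> 0\<^sub>v ?n" and Av: "A *\<^sub>v v = e \<cdot>\<^sub>v v"
    using A unfolding eigenvector_def by auto
  obtain W c where W: "W \<in> carrier_mat ?n ?n" and WW: "transpose_mat W * W = 1\<^sub>m ?n"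
    and W0: "col W 0 = c \<cdot>\<^sub>v v"
    using orthogonal_mat_first_col[OF v] by metis
  have Wt: "transpose_mat W \<in> carrier_mat ?n ?n" using W by simp
  have WW': "W * transpose_mat W = 1\<^sub>m ?n" by (rule mat_mult_left_right_inverse[OF Wt W WW])
  define A' where "A' = transpose_mat W * (A * W)"
  have A': "A' \<in> carrier_mat ?n ?n" unfolding A'_def using A W by auto
  have "transpose_mat A' = transpose_mat (A * W) * W"
    unfolding A'_def using transpose_mult[OF Wt, of "A * W" ?n] A W by simp
  also have "\<dots> = transpose_mat W * A * W" using transpose_mult[OF A W] sym by simp
  finally have symA': "transpose_mat A' = A'" unfolding A'_def using assoc_mult_mat[OF Wt A W] by simp
  have col0: "A' $$ (i, 0) = (if i = 0 then e else 0)" if i: "i < ?n" for i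
  proof -
    have "A' $$ (i, 0) = row (transpose_mat W) i \<bullet> col (A * W) 0"
      unfolding A'_def using A W i by simp
    also have "col (A * W) 0 = A *\<^sub>v col W 0" using A W by (intro eq_vecI) auto
    also have "\<dots> = e \<cdot>\<^sub>v col W 0" unfolding W0 mult_mat_vec[OF A v(1)] Av
      by (simp add: smult_smult_assoc mult.commute)
    also have "row (transpose_mat W) i \<bullet> (e \<cdot>\<^sub>v col W 0) = e * (transpose_mat W * W) $$ (i, 0)"
      using W i by simp
    finally show ?thesis unfolding WW using i by simp
  qed
  have row0: "A' $$ (0, i) = (if i = 0 then e else 0)" if i: "i < ?n" for i
    using col0[OF i] symA' A' i by (metis carrier_matD index_transpose_mat(1) zero_less_Suc)
  define A3 where "A3 = mat m m (\<lambda>(i, j). A' $$ (Suc i, Suc j))"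
  have A3: "A3 \<in> carrier_mat m m" by (simp add: A3_def)
  have "transpose_mat A3 = A3"
    unfolding A3_def using symA' A'
    by (intro eq_matI) (auto, metis Suc_less_eq carrier_matD index_transpose_mat(1))
  from Suc.IH[OF A3 this] obtain U3 l3 where U3: "U3 \<in> carrier_mat m m"
    and UU3: "transpose_mat U3 * U3 = 1\<^sub>m m" and A3e: "A3 = U3 * diag_of m l3 * transpose_mat U3"
    by blast
  let ?E = "mat 1 1 (\<lambda>_. e)"
  define V where "V = four_block_mat (1\<^sub>m 1) (0\<^sub>m 1 m) (0\<^sub>m m 1) U3"
  define l where "l i = (case i of 0 \<Rightarrow> e | Suc j \<Rightarrow> l3 j)" for i
  have V: "V \<in> carrier_mat ?n ?n" unfolding V_def using U3 by auto
  have Vt: "transpose_mat V = four_block_mat (1\<^sub>m 1) (0\<^sub>m 1 m) (0\<^sub>m m 1) (transpose_mat U3)"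
    unfolding V_def using U3 by (subst transpose_four_block_mat) auto
  have Vtc: "transpose_mat V \<in> carrier_mat ?n ?n" using V by simp
  have D: "diag_of ?n l = four_block_mat ?E (0\<^sub>m 1 m) (0\<^sub>m m 1) (diag_of m l3)"
    by (rule eq_matI) (auto simp: diag_of_def l_def split: nat.splits)
  have VV: "transpose_mat V * V = 1\<^sub>m ?n"
    unfolding Vt unfolding V_def using U3 UU3 four_block_one_mat[of 1 m]
    by (subst mult_four_block_mat) auto
  have "V * diag_of ?n l = four_block_mat ?E (0\<^sub>m 1 m) (0\<^sub>m m 1) (U3 * diag_of m l3)"
    unfolding V_def D using U3 diag_of_carrier[of m l3]
    by (subst mult_four_block_mat[of _ 1 1 _ m _ m _ _ 1 _ m])
      (auto simp: left_mult_zero_mat[OF diag_of_carrier])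
  note VD = this
  have UD: "U3 * diag_of m l3 \<in> carrier_mat m m" using U3 by (rule mult_carrier_mat) simp
  have UDU: "U3 * diag_of m l3 * transpose_mat U3 \<in> carrier_mat m m" using U3 by (intro mult_carrier_mat[OF UD]) simp
  have "V * diag_of ?n l * transpose_mat V = four_block_mat ?E (0\<^sub>m 1 m) (0\<^sub>m m 1) A3"
    unfolding VD Vt A3e using U3 diag_of_carrier[of m l3]
    by (subst mult_four_block_mat[of _ 1 1 _ m _ m _ _ 1 _ m])
      (auto simp: right_mult_zero_mat[OF UD] left_add_zero_mat[OF UDU])
  also have "\<dots> = A'"
  proof (rule eq_matI)
    fix i j assume "i < dim_row A'" "j < dim_col A'"
    then show "four_block_mat ?E (0\<^sub>m 1 m) (0\<^sub>m m 1) A3 $$ (i, j) = A' $$ (i, j)"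
      using A' col0[of i] row0[of j] by (cases i; cases j) (auto simp: A3_def)
  qed (use A' A3 in auto)
  finally have VA: "V * diag_of ?n l * transpose_mat V = A'" .
  define U where "U = W * V"
  have U: "U \<in> carrier_mat ?n ?n" using W V by (simp add: U_def)
  have Ut: "transpose_mat U = transpose_mat V * transpose_mat W"
    unfolding U_def using transpose_mult[OF W V] .
  have "transpose_mat U * U = transpose_mat V * (transpose_mat W * W) * V"
    unfolding Ut unfolding U_def using W Wt V Vtc
    by (simp add: assoc_mult_mat[of _ ?n ?n _ ?n _ ?n] mult_carrier_mat[of _ ?n ?n])
  also have "\<dots> = 1\<^sub>m ?n" unfolding WW using V Vtc VV by simp
  finally have UU: "transpose_mat U * U = 1\<^sub>m ?n" .
  have "U * diag_of ?n l * transpose_mat U = W * (V * diag_of ?n l * transpose_mat V) * transpose_mat W"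
    unfolding Ut unfolding U_def using W Wt V Vtc diag_of_carrier[of ?n l]
    by (simp add: assoc_mult_mat[of _ ?n ?n _ ?n _ ?n] mult_carrier_mat[of _ ?n ?n])
  also have "\<dots> = (W * transpose_mat W) * A * (W * transpose_mat W)"
    unfolding VA A'_def using W Wt A by (simp add: assoc_mult_mat[of _ ?n ?n _ ?n _ ?n] mult_carrier_mat[of _ ?n ?n])
  also have "\<dots> = A" unfolding WW' using A by simp
  finally show ?case using U UU by metis
qed

lemma conj_diag_index:
  assumes "U \<in> carrier_mat n n" "i < n" "j < n"
  shows "(U * diag_of n l * transpose_mat U) $$ (i, j) = (\<Sum>k<n. U $$ (i, k) * l k * U $$ (j, k))"
proof -
  have "(U * diag_of n l) $$ (i, k) = U $$ (i, k) * l k" if "k < n" for k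
  proof -
    have "(U * diag_of n l) $$ (i, k) = (\<Sum>m<n. U $$ (i, m) * (if m = k then l m else 0))"
      using assms that by (simp add: scalar_prod_def diag_of_def lessThan_atLeast0)
    also have "\<dots> = (\<Sum>m<n. if m = k then U $$ (i, m) * l m else 0)" by (intro sum.cong) auto
    finally show ?thesis using that by simp
  qed
  note UD = this
  define P where "P = U * diag_of n l"
  have "P \<in> carrier_mat n n" using assms(1) by (simp add: P_def mult_carrier_mat[of _ n n])
  then have "(P * transpose_mat U) $$ (i, j) = (\<Sum>k<n. P $$ (i, k) * U $$ (j, k))"
    using assms by (simp add: scalar_prod_def lessThan_atLeast0)
  also have "\<dots> = (\<Sum>k<n. U $$ (i, k) * l k * U $$ (j, k))"
    by (intro sum.cong refl) (simp add: P_def UD del: index_mult_mat(1))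
  finally show ?thesis by (simp only: P_def)
qed

lemma mult_diag_of: "diag_of n l * diag_of n l' = diag_of n (\<lambda>i. l i * l' i)"
proof (rule eq_matI)
  fix i j assume "i < dim_row (diag_of n (\<lambda>i. l i * l' i))" "j < dim_col (diag_of n (\<lambda>i. l i * l' i))"
  then have ij: "i < n" "j < n" by (simp_all add: diag_of_def)
  then have "(diag_of n l * diag_of n l') $$ (i, j)
     = (\<Sum>m<n. (if i = m then l i else 0) * (if m = j then l' m else 0))"
    by (simp add: scalar_prod_def diag_of_def lessThan_atLeast0)
  also have "\<dots> = (\<Sum>m<n. if m = i then (if i = j then l i * l' i else 0) else 0)"
    by (intro sum.cong) auto
  finally show "(diag_of n l * diag_of n l') $$ (i, j) = diag_of n (\<lambda>i. l i * l' i) $$ (i, j)"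
    using ij by (simp add: diag_of_def)
qed (simp_all add: diag_of_def)

lemma diag_of_one: "(\<And>i. i < n \<Longrightarrow> l i = 1) \<Longrightarrow> diag_of n l = 1\<^sub>m n"
  by (rule eq_matI) (auto simp: diag_of_def)

lemma transpose_diag_of: "transpose_mat (diag_of n l) = diag_of n l"
  by (rule eq_matI) (auto simp: diag_of_def)

lemma conj_diag_mult:
  assumes U: "U \<in> carrier_mat n n" and UU: "transpose_mat U * U = 1\<^sub>m n"
  shows "U * diag_of n l * transpose_mat U * (U * diag_of n l' * transpose_mat U)
    = U * diag_of n (\<lambda>i. l i * l' i) * transpose_mat U"
proof -
  have Ut: "transpose_mat U \<in> carrier_mat n n" using U by simp
  note [simp] = assoc_mult_mat[of _ n n _ n _ n] mult_carrier_mat[of _ n n]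
  have "U * diag_of n l * transpose_mat U * (U * diag_of n l' * transpose_mat U)
    = U * (diag_of n l * ((transpose_mat U * U) * (diag_of n l' * transpose_mat U)))"
    using U Ut by simp
  also have "\<dots> = U * ((diag_of n l * diag_of n l') * transpose_mat U)"
    unfolding UU using U Ut by (simp add: left_mult_one_mat[of _ n n])
  finally show ?thesis unfolding mult_diag_of using U Ut by simp
qed

lemma orthogonal_transpose:
  assumes "U \<in> carrier_mat n n" "transpose_mat U * U = (1\<^sub>m n :: real mat)"
  shows "U * transpose_mat U = 1\<^sub>m n"
  using mat_mult_left_right_inverse[OF _ assms(1,2)] assms(1) by simp

lemma orthogonal_col_norm:
  assumes "U \<in> carrier_mat n n" "transpose_mat U * U = (1\<^sub>m n :: real mat)" "k < n"
  shows "(\<Sum>i<n. U $$ (i, k) * U $$ (i, k)) = 1"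
proof -
  have "(transpose_mat U * U) $$ (k, k) = (\<Sum>i<n. U $$ (i, k) * U $$ (i, k))"
    using assms(1,3) by (simp add: scalar_prod_def lessThan_atLeast0)
  then show ?thesis using assms by simp
qed

lemma mat_trace_conj_diag:
  assumes "U \<in> carrier_mat n n" "transpose_mat U * U = 1\<^sub>m n"
  shows "mat_trace (U * diag_of n l * transpose_mat U) = (\<Sum>k<n. l k)"
proof -
  have "mat_trace (U * diag_of n l * transpose_mat U) = (\<Sum>i<n. \<Sum>k<n. U $$ (i, k) * l k * U $$ (i, k))"
    unfolding mat_trace_def using assms(1)
    by (intro sum.cong) (auto intro: conj_diag_index simp del: index_mult_mat(1))
  also have "\<dots> = (\<Sum>k<n. l k * (\<Sum>i<n. U $$ (i, k) * U $$ (i, k)))"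
    by (subst sum.swap) (simp add: sum_distrib_left mult_ac)
  finally show ?thesis using assms by (simp add: orthogonal_col_norm)
qed

lemma det_conj_diag:
  assumes U: "U \<in> carrier_mat n n" and UU: "transpose_mat U * U = 1\<^sub>m n"
  shows "det (U * diag_of n l * transpose_mat U) = (\<Prod>k<n. l k)"
proof -
  have "det (U * diag_of n l * transpose_mat U) = det (diag_of n l) * (det (transpose_mat U) * det U)"
    using U by (simp add: det_mult[of _ n] mult_carrier_mat[of _ n n])
  also have "det (transpose_mat U) * det U = 1"
    using det_mult[of "transpose_mat U" n U] U UU by simp
  also have "det (diag_of n l) = prod_list (diag_mat (diag_of n l))"
    by (rule det_upper_triangular[of _ n]) (auto simp: diag_of_def)
  also have "\<dots> = (\<Prod>k<n. l k)"
    by (simp add: diag_mat_def diag_of_def prod.list_conv_set_nth lessThan_atLeast0 interv_sum_list_conv_sum_set_nat)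
  finally show ?thesis by simp
qed

lemma conj_diag_eigenvalue:
  assumes U: "U \<in> carrier_mat n n" and UU: "transpose_mat U * U = 1\<^sub>m n" and k: "k < n"
  shows "eigenvalue (U * diag_of n l * transpose_mat U) (l k)"
proof -
  let ?C = "U * diag_of n l * transpose_mat U"
  have C: "?C \<in> carrier_mat n n" using U by (simp add: mult_carrier_mat[of _ n n])
  have "?C * U = U * diag_of n l"
    using U UU
    by (simp add: assoc_mult_mat[of _ n n _ n _ n] mult_carrier_mat[of _ n n] right_mult_one_mat[of _ n n])
  moreover have "?C *\<^sub>v col U k = col (?C * U) k" using C U k by (intro eq_vecI) auto
  moreover have "col (U * diag_of n l) k = l k \<cdot>\<^sub>v col U k"
  proof (rule eq_vecI)
    fix i assume "i < dim_vec (l k \<cdot>\<^sub>v col U k)"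
    then have i: "i < n" using U by simp
    have "col (U * diag_of n l) k $ i = (\<Sum>m<n. U $$ (i, m) * (if m = k then l m else 0))"
      using i k U by (simp add: scalar_prod_def diag_of_def lessThan_atLeast0)
    also have "\<dots> = (\<Sum>m<n. if m = k then U $$ (i, m) * l m else 0)" by (intro sum.cong) auto
    finally show "col (U * diag_of n l) k $ i = (l k \<cdot>\<^sub>v col U k) $ i" using i k U by simp
  qed (use U in auto)
  moreover have "col U k \<noteq> 0\<^sub>v n"
  proof
    assume 0: "col U k = 0\<^sub>v n"
    have "U $$ (i, k) = 0" if "i < n" for i using arg_cong[OF 0, of "\<lambda>v. v $ i"] that k U by simp
    then show False using orthogonal_col_norm[OF U UU k] by simp
  qed
  ultimately show ?thesis unfolding eigenvalue_def eigenvector_def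
    using C U by (intro exI[of _ "col U k"]) auto
qed

lemma mat_inv_eq:
  assumes B: "B \<in> carrier_mat n n" and X: "X \<in> carrier_mat n n" and BX: "B * X = 1\<^sub>m n" and XB: "X * B = 1\<^sub>m n"
  shows "mat_inv B = X"
proof -
  have n: "dim_row B = n" using B by simp
  show ?thesis unfolding mat_inv_def n
  proof (rule some_equality)
    fix Y assume Y: "Y \<in> carrier_mat n n \<and> B * Y = 1\<^sub>m n \<and> Y * B = 1\<^sub>m n"
    have "Y = Y * (B * X)" using Y BX right_mult_one_mat[of Y n n] by simp
    also have "\<dots> = (Y * B) * X" using assoc_mult_mat[of Y n n B n X n] Y B X by simp
    finally show "Y = X" using Y left_mult_one_mat[OF X] by simp
  qed (use assms in simp)
qed

text \<open>Nothing is known about the chosen matrix until some generalized inverse is exhibited.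
  Inverting the eigenvalues gives one, where \<open>inverse 0 = 0\<close> takes care of the singular
  directions.\<close>

lemma gen_inverse_symmetric:
  assumes M: "M \<in> carrier_mat n n" and sym: "transpose_mat M = M"
  shows "gen_inverse M \<in> carrier_mat n n" "M * gen_inverse M * M = M"
proof -
  obtain U l where U: "U \<in> carrier_mat n n" and UU: "transpose_mat U * U = 1\<^sub>m n"
    and Me: "M = U * diag_of n l * transpose_mat U"
    using real_spectral_theorem[OF M sym] by blast
  define G where "G = U * diag_of n (\<lambda>i. inverse (l i)) * transpose_mat U"
  have "M * G * M = U * diag_of n (\<lambda>i. l i * inverse (l i) * l i) * transpose_mat U"
    unfolding Me G_def conj_diag_mult[OF U UU] ..
  also have "(\<lambda>i. l i * inverse (l i) * l i) = l"
  proof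
    fix i show "l i * inverse (l i) * l i = l i" by (cases "l i = 0") auto
  qed
  finally have "G \<in> carrier_mat (dim_col M) (dim_row M) \<and> M * G * M = M"
    using U M by (auto simp: Me[symmetric] G_def intro!: mult_carrier_mat)
  then have "gen_inverse M \<in> carrier_mat (dim_col M) (dim_row M) \<and> M * gen_inverse M * M = M"
    unfolding gen_inverse_def by (rule someI)
  then show "gen_inverse M \<in> carrier_mat n n" "M * gen_inverse M * M = M" using M by auto
qed

section \<open>Positive semidefinite matrices and ranges\<close>

definition psd :: "nat \<Rightarrow> real mat \<Rightarrow> bool" where
  "psd n M \<longleftrightarrow> M \<in> carrier_mat n n \<and> transpose_mat M = M
     \<and> (\<forall>v \<in> carrier_vec n. 0 \<le> v \<bullet> (M *\<^sub>v v))"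

lemma symmetric_scalar_prod:
  fixes M :: "real mat"
  assumes M: "M \<in> carrier_mat n n" and sym: "transpose_mat M = M"
    and v: "v \<in> carrier_vec n" and w: "w \<in> carrier_vec n"
  shows "v \<bullet> (M *\<^sub>v w) = w \<bullet> (M *\<^sub>v v)"
proof -
  have s: "M $$ (i, j) = M $$ (j, i)" if "i < n" "j < n" for i j
    using sym M that by (metis carrier_matD index_transpose_mat(1))
  have "v \<bullet> (M *\<^sub>v w) = (\<Sum>i<n. \<Sum>j<n. v $ i * (M $$ (i, j) * w $ j))"
    using M v w by (simp add: scalar_prod_def lessThan_atLeast0 sum_distrib_left)
  also have "\<dots> = (\<Sum>j<n. \<Sum>i<n. v $ i * (M $$ (i, j) * w $ j))" by (rule sum.swap)
  also have "\<dots> = (\<Sum>j<n. \<Sum>i<n. w $ j * (M $$ (j, i) * v $ i))"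
    by (intro sum.cong refl) (auto simp: s mult_ac)
  also have "\<dots> = w \<bullet> (M *\<^sub>v v)"
    using M v w by (simp add: scalar_prod_def lessThan_atLeast0 sum_distrib_left)
  finally show ?thesis .
qed

text \<open>Moving from \<open>y\<close> in the direction \<open>z = M y\<close> changes the form by
  \<open>2 t a + t^2 c\<close> with \<open>a\<close> the squared norm of \<open>z\<close>.
  Nonnegativity for small negative \<open>t\<close> forces \<open>a = 0\<close>.\<close>

lemma psd_null:
  assumes psd: "psd n M" and y: "y \<in> carrier_vec n" and 0: "y \<bullet> (M *\<^sub>v y) = 0"
  shows "M *\<^sub>v y = 0\<^sub>v n"
proof -
  have M: "M \<in> carrier_mat n n" and sym: "transpose_mat M = M" using psd by (auto simp: psd_def)
  define z where "z = M *\<^sub>v y"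
  have z: "z \<in> carrier_vec n" using M y by (simp add: z_def)
  define a where "a = z \<bullet> z"
  define c where "c = z \<bullet> (M *\<^sub>v z)"
  have c0: "c \<ge> 0" using psd z by (simp add: psd_def c_def)
  have q: "2 * t * a + t * t * c \<ge> 0" for t
  proof -
    have tz: "t \<cdot>\<^sub>v z \<in> carrier_vec n" using z by simp
    have Mz: "M *\<^sub>v z \<in> carrier_vec n" using M z by simp
    have "0 \<le> (y + t \<cdot>\<^sub>v z) \<bullet> (M *\<^sub>v (y + t \<cdot>\<^sub>v z))" using psd y tz by (simp add: psd_def)
    also have "M *\<^sub>v (y + t \<cdot>\<^sub>v z) = z + t \<cdot>\<^sub>v (M *\<^sub>v z)"
      using mult_add_distrib_mat_vec[OF M y tz] mult_mat_vec[OF M z] by (simp add: z_def)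
    also have "(y + t \<cdot>\<^sub>v z) \<bullet> (z + t \<cdot>\<^sub>v (M *\<^sub>v z)) = y \<bullet> z + t * (y \<bullet> (M *\<^sub>v z)) + t * (z \<bullet> z) + t * t * c"
      using y z Mz by (simp add: add_scalar_prod_distrib[of _ n] scalar_prod_add_distrib[of _ n] c_def ring_distribs)
    also have "y \<bullet> z = 0" using 0 by (simp add: z_def)
    also have "y \<bullet> (M *\<^sub>v z) = a" using symmetric_scalar_prod[OF M sym y z] by (simp add: a_def z_def)
    finally show ?thesis by (simp add: a_def)
  qed
  have "a = 0"
  proof (rule ccontr)
    assume "a \<noteq> 0"
    \<comment> \<open>Close to the minimizer \<open>t = - a / c\<close>, with 1 added so that
      \<open>c = 0\<close> is covered; at \<open>t = -e\<close> the quadratic equals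
      \<open>- e^2 (c + 2)\<close>.\<close>
    define e where "e = a / (c + 1)"
    have ae: "a = e * (c + 1)" using c0 by (simp add: e_def)
    have "2 * (- e) * a + (- e) * (- e) * c = - ((e * e) * (c + 2))"
      unfolding ae by (simp add: algebra_simps)
    moreover have "e * e > 0" using \<open>a \<noteq> 0\<close> ae by (simp add: zero_less_power2[unfolded power2_eq_square])
    then have "(e * e) * (c + 2) > 0" by (rule mult_pos_pos) (use c0 in simp)
    ultimately show False using q[of "- e"] by linarith
  qed
  then have "(\<Sum>i<n. z $ i * z $ i) = 0" using z by (simp add: a_def scalar_prod_def lessThan_atLeast0)
  then have "\<forall>i<n. z $ i = 0" by (subst (asm) sum_nonneg_eq_0_iff) auto
  then show ?thesis using z unfolding z_def[symmetric] by (intro eq_vecI) auto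
qed

lemma mat_range_factor:
  assumes M: "M \<in> carrier_mat n n" and K: "K \<in> carrier_mat n s" and sub: "mat_range K \<subseteq> mat_range M"
  obtains Z where "Z \<in> carrier_mat n s" "K = M * Z"
proof -
  have "\<exists>z. z \<in> carrier_vec n \<and> col K j = M *\<^sub>v z" if j: "j < s" for j
  proof -
    have "col K j = K *\<^sub>v unit_vec s j" using K j by (intro eq_vecI) auto
    then have "col K j \<in> mat_range K" using K by (auto simp: mat_range_def)
    then show ?thesis using sub M by (auto simp: mat_range_def)
  qed
  then obtain z where z: "\<And>j. j < s \<Longrightarrow> z j \<in> carrier_vec n" "\<And>j. j < s \<Longrightarrow> col K j = M *\<^sub>v z j"
    by metis
  define Z where "Z = mat_of_cols n (map z [0..<s])"
  have Z: "Z \<in> carrier_mat n s" unfolding Z_def using mat_of_cols_carrier(1)[of n "map z [0..<s]"] by simp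
  have colZ: "col Z j = z j" if "j < s" for j unfolding Z_def using that z(1) by (subst col_mat_of_cols) auto
  have "K = M * Z"
  proof (rule eq_matI)
    fix i j assume "i < dim_row (M * Z)" "j < dim_col (M * Z)"
    then have ij: "i < n" "j < s" using M Z by auto
    have "K $$ (i, j) = col K j $ i" using ij K by simp
    also have "\<dots> = (M * Z) $$ (i, j)" using ij M Z z(2)[of j] colZ[of j] by simp
    finally show "K $$ (i, j) = (M * Z) $$ (i, j)" .
  qed (use M K Z in auto)
  with Z show thesis using that by blast
qed

section \<open>Optimality\<close>

lemma diag_of_mult_inverse:
  assumes "\<And>k. k < n \<Longrightarrow> b k > (0::real)"
  shows "diag_of n (\<lambda>i. b i * (1 / b i)) = 1\<^sub>m n" "diag_of n (\<lambda>i. (1 / b i) * b i) = 1\<^sub>m n"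
  using assms by (force intro!: diag_of_one)+

lemma mult_mat_vec_scalar_prod:
  fixes A :: "real mat"
  assumes "A \<in> carrier_mat n s" "a \<in> carrier_vec s" "c \<in> carrier_vec n"
  shows "(A *\<^sub>v a) \<bullet> c = a \<bullet> (transpose_mat A *\<^sub>v c)"
proof -
  have "(A *\<^sub>v a) \<bullet> c = c \<bullet> (A *\<^sub>v a)" using assms by (intro comm_scalar_prod[of _ n]) auto
  also have "\<dots> = (transpose_mat A *\<^sub>v c) \<bullet> a" using transpose_vec_mult_scalar[OF assms] by simp
  also have "\<dots> = a \<bullet> (transpose_mat A *\<^sub>v c)" using assms by (intro comm_scalar_prod[of _ s]) auto
  finally show ?thesis .
qed

text \<open>The criteria see only the eigenvalues of \<open>C\<close>, and these are controlled
  through their sum. Hence the result pairs a positive diagonalization with the diagonal entries of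
  the matrix inequality.\<close>

lemma estimable_information_inverse:
  assumes psd: "psd n M" and K: "K \<in> carrier_mat n s" and KK: "transpose_mat K * K = 1\<^sub>m s"
    and sub: "mat_range K \<subseteq> mat_range M"
  defines "C \<equiv> mat_inv (transpose_mat K * gen_inverse M * K)"
  obtains W l where "W \<in> carrier_mat s s" "transpose_mat W * W = 1\<^sub>m s" "\<And>k. k < s \<Longrightarrow> l k > 0"
    "C = W * diag_of s l * transpose_mat W"
    "\<And>j. j < s \<Longrightarrow> C $$ (j, j) \<le> (transpose_mat K * M * K) $$ (j, j)"
proof -
  have M: "M \<in> carrier_mat n n" and symM: "transpose_mat M = M" using psd by (auto simp: psd_def)
  obtain Z where Z: "Z \<in> carrier_mat n s" and KZ: "K = M * Z" using mat_range_factor[OF M K sub] .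
  define Zt where "Zt = transpose_mat Z"
  define Kt where "Kt = transpose_mat K"
  have Zt: "Zt \<in> carrier_mat s n" and Kt: "Kt \<in> carrier_mat s n" using Z K by (auto simp: Zt_def Kt_def)
  have KtZ: "Kt = Zt * M" unfolding Kt_def Zt_def KZ using transpose_mult[OF M Z] symM by simp
  define G where "G = gen_inverse M"
  have G: "G \<in> carrier_mat n n" and MGM: "M * G * M = M"
    using gen_inverse_symmetric[OF M symM] by (auto simp: G_def)
  define B where "B = Kt * G * K"
  note assoc = assoc_mult_mat[of _ n n _ n _ n] assoc_mult_mat[of _ n n _ n _ s] assoc_mult_mat[of _ n n _ s _ s]
    assoc_mult_mat[of _ s n _ n _ n] assoc_mult_mat[of _ s n _ n _ s] assoc_mult_mat[of _ s n _ s _ s]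
    assoc_mult_mat[of _ s s _ n _ n] assoc_mult_mat[of _ s s _ n _ s] assoc_mult_mat[of _ s s _ s _ s]
    assoc_mult_mat[of _ s s _ s _ n] assoc_mult_mat[of _ n s _ s _ s]
  note carr = mult_carrier_mat[of _ n n _ n] mult_carrier_mat[of _ n n _ s] mult_carrier_mat[of _ s n _ n]
    mult_carrier_mat[of _ s n _ s] mult_carrier_mat[of _ s s _ s] mult_carrier_mat[of _ s s _ n] mult_carrier_mat[of _ n s _ s]
  \<comment> \<open>With \<open>K = M Z\<close> on both sides, \<open>G\<close> occurs only inside
    \<open>M G M = M\<close>, so the choice of generalized inverse drops out.\<close>
  have "B = Zt * ((M * G * M) * Z)" unfolding B_def KtZ KZ using Zt M G Z by (simp add: assoc carr)
  then have BZ: "B = Zt * K" unfolding MGM KZ .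
  then have BZ': "B = Kt * Z" unfolding KtZ KZ using Zt M Z by (simp add: assoc)
  have Bc: "B \<in> carrier_mat s s" unfolding BZ using Zt K by simp
  have symB: "transpose_mat B = B"
    unfolding BZ using transpose_mult[OF Zt K] BZ' BZ by (simp add: Zt_def Kt_def)
  obtain W b where W: "W \<in> carrier_mat s s" and WW: "transpose_mat W * W = 1\<^sub>m s"
    and Be: "B = W * diag_of s b * transpose_mat W"
    using real_spectral_theorem[OF Bc symB] by blast
  \<comment> \<open>An eigenvalue of \<open>B\<close> is \<open>y^T M y\<close> with
    \<open>y = Z w\<close>. If it vanished, then \<open>M y = K w\<close> would vanish, and
    \<open>K^T K = I\<close> would give \<open>w = 0\<close>.\<close>
  have bpos: "b j > 0" if j: "j < s" for j
  proof -
    define w where "w = col W j"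
    have w: "w \<in> carrier_vec s" unfolding w_def using col_carrier_vec[OF j W] .
    have ww: "w \<bullet> w = 1"
      using orthogonal_col_norm[OF W WW j] W j by (simp add: w_def scalar_prod_def lessThan_atLeast0)
    have "B * W = W * diag_of s b"
      unfolding Be using W WW
      by (simp add: assoc_mult_mat[of _ s s _ s _ s] mult_carrier_mat[of _ s s] right_mult_one_mat[of _ s s])
    have "transpose_mat W * B * W = diag_of s b"
      unfolding assoc_mult_mat[OF transpose_carrier_mat[THEN iffD2, OF W] Bc W] \<open>B * W = W * diag_of s b\<close>
      using W WW assoc_mult_mat[of "transpose_mat W" s s W s "diag_of s b" s] left_mult_one_mat[OF diag_of_carrier]
      by simp
    then have "b j = (transpose_mat W * (B * W)) $$ (j, j)"
      using j W Bc assoc_mult_mat[of "transpose_mat W" s s B s W s] by (simp add: diag_of_def)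
    also have "\<dots> = w \<bullet> (B *\<^sub>v w)"
    proof -
      have "col (B * W) j = B *\<^sub>v w" using W Bc j by (intro eq_vecI) (auto simp: w_def)
      then show ?thesis using W Bc j by (simp add: w_def)
    qed
    finally have bw: "b j = w \<bullet> (B *\<^sub>v w)" .
    define y where "y = Z *\<^sub>v w"
    have y: "y \<in> carrier_vec n" using Z w by (simp add: y_def)
    have Kw: "M *\<^sub>v y = K *\<^sub>v w" unfolding y_def KZ using assoc_mult_mat_vec[OF M Z w] by simp
    have "B *\<^sub>v w = Zt *\<^sub>v (K *\<^sub>v w)" unfolding BZ using assoc_mult_mat_vec[OF Zt K w] .
    then have "w \<bullet> (B *\<^sub>v w) = y \<bullet> (M *\<^sub>v y)"
      unfolding Kw unfolding Zt_def y_def using mult_mat_vec_scalar_prod[OF Z w, of "K *\<^sub>v w"] K w by simp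
    then have bj: "b j = y \<bullet> (M *\<^sub>v y)" using bw by simp
    have "b j \<noteq> 0"
    proof
      assume "b j = 0"
      then have "M *\<^sub>v y = 0\<^sub>v n" using psd_null[OF psd y] bj by simp
      then have "K *\<^sub>v w = 0\<^sub>v n" unfolding Kw .
      then have "Kt *\<^sub>v (K *\<^sub>v w) = 0\<^sub>v s" using Kt by (intro eq_vecI) auto
      then have "w = 0\<^sub>v s" using assoc_mult_mat_vec[OF Kt K w] KK w by (simp add: Kt_def)
      then show False using ww by simp
    qed
    moreover have "b j \<ge> 0" unfolding bj using psd y by (simp add: psd_def)
    ultimately show ?thesis by simp
  qed
  define X where "X = W * diag_of s (\<lambda>i. 1 / b i) * transpose_mat W"
  have X: "X \<in> carrier_mat s s" using W by (simp add: X_def mult_carrier_mat[of _ s s])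
  have one: "W * 1\<^sub>m s * transpose_mat W = 1\<^sub>m s" using orthogonal_transpose[OF W WW] W by simp
  have BX: "B * X = 1\<^sub>m s" "X * B = 1\<^sub>m s"
    unfolding Be X_def conj_diag_mult[OF W WW] using diag_of_mult_inverse[of s b] bpos one by simp_all
  have CX: "C = X" unfolding C_def G_def[symmetric] Kt_def[symmetric] B_def[symmetric]
    using mat_inv_eq[OF Bc X BX] .
  have symX: "transpose_mat X = X"
    unfolding X_def using W transpose_mult[of "W * diag_of s (\<lambda>i. 1 / b i)" s s "transpose_mat W" s]
      transpose_mult[of W s s "diag_of s (\<lambda>i. 1 / b i)" s]
    by (simp add: transpose_diag_of assoc_mult_mat[of _ s s _ s _ s] mult_carrier_mat[of _ s s])
  have diag: "X $$ (j, j) \<le> (Kt * M * K) $$ (j, j)" if j: "j < s" for j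
  proof -
    define e where "e = (unit_vec s j :: real Matrix.vec)"
    have e: "e \<in> carrier_vec s" by (simp add: e_def)
    have ee: "e \<bullet> (A *\<^sub>v e) = A $$ (j, j)" if "A \<in> carrier_mat s s" for A :: "real mat"
      using that j by (simp add: e_def)
    \<comment> \<open>Column \<open>j\<close> of \<open>Z C\<close> and, below, of \<open>K\<close>.
      The products \<open>u^T M u\<close>, \<open>u^T M v\<close> and \<open>v^T M u\<close> all
      equal \<open>X_jj\<close>, so the form at \<open>u - v\<close> is
      \<open>v^T M v - X_jj\<close>.\<close>
    define u where "u = Z *\<^sub>v (X *\<^sub>v e)"
    define v where "v = K *\<^sub>v e"
    have Xe: "X *\<^sub>v e \<in> carrier_vec s" using X e by simp
    have u: "u \<in> carrier_vec n" and v: "v \<in> carrier_vec n" using Z X K e by (auto simp: u_def v_def)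
    have Mu: "M *\<^sub>v u = K *\<^sub>v (X *\<^sub>v e)" unfolding u_def KZ using assoc_mult_mat_vec[OF M Z Xe] by simp
    have Mu': "M *\<^sub>v u \<in> carrier_vec n" and Mv: "M *\<^sub>v v \<in> carrier_vec n" using M u v by auto
    have "u \<bullet> (M *\<^sub>v u) = (X *\<^sub>v e) \<bullet> (B *\<^sub>v (X *\<^sub>v e))"
      unfolding BZ assoc_mult_mat_vec[OF Zt K Xe] unfolding Mu
      unfolding u_def Zt_def using K Xe by (intro mult_mat_vec_scalar_prod[OF Z Xe]) auto
    also have "B *\<^sub>v (X *\<^sub>v e) = e" using assoc_mult_mat_vec[OF Bc X e] BX e by simp
    also have "(X *\<^sub>v e) \<bullet> e = X $$ (j, j)" using ee[OF X] comm_scalar_prod[OF Xe e] by simp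
    finally have uu: "u \<bullet> (M *\<^sub>v u) = X $$ (j, j)" .
    have "v \<bullet> (M *\<^sub>v u) = e \<bullet> (Kt *\<^sub>v (K *\<^sub>v (X *\<^sub>v e)))"
      unfolding Mu unfolding v_def Kt_def using K Xe by (intro mult_mat_vec_scalar_prod[OF K e]) auto
    also have "Kt *\<^sub>v (K *\<^sub>v (X *\<^sub>v e)) = X *\<^sub>v e"
      using assoc_mult_mat_vec[OF Kt K Xe] KK Xe by (simp add: Kt_def)
    finally have vu: "v \<bullet> (M *\<^sub>v u) = X $$ (j, j)" using ee[OF X] by simp
    have uv: "u \<bullet> (M *\<^sub>v v) = X $$ (j, j)" using symmetric_scalar_prod[OF M symM u v] vu by simp
    have "v \<bullet> (M *\<^sub>v v) = e \<bullet> (Kt *\<^sub>v (M *\<^sub>v v))"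
      using Mv unfolding v_def Kt_def by (intro mult_mat_vec_scalar_prod[OF K e]) auto
    also have "Kt *\<^sub>v (M *\<^sub>v v) = (Kt * M * K) *\<^sub>v e"
      unfolding v_def using assoc_mult_mat_vec[of "Kt * M" s n K s e] assoc_mult_mat_vec[of Kt s n M n "K *\<^sub>v e"] Kt M K e
      by simp
    finally have vv: "v \<bullet> (M *\<^sub>v v) = (Kt * M * K) $$ (j, j)" using ee[of "Kt * M * K"] Kt M K by simp
    have "0 \<le> (u - v) \<bullet> (M *\<^sub>v (u - v))" using psd u v by (simp add: psd_def)
    also have "M *\<^sub>v (u - v) = M *\<^sub>v u - M *\<^sub>v v" using mult_minus_distrib_mat_vec[OF M u v] .
    also have "(u - v) \<bullet> (M *\<^sub>v u - M *\<^sub>v v)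
      = (u \<bullet> (M *\<^sub>v u) - u \<bullet> (M *\<^sub>v v)) - (v \<bullet> (M *\<^sub>v u) - v \<bullet> (M *\<^sub>v v))"
      using u v Mu' Mv by (simp add: minus_scalar_prod_distrib[of _ n] scalar_prod_minus_distrib[of _ n])
    finally show ?thesis unfolding uu uv vu vv by simp
  qed
  show thesis
    by (rule that[OF W WW, of "\<lambda>i. 1 / b i"]) (use bpos diag in \<open>simp_all add: CX X_def[symmetric] Kt_def\<close>)
qed

section \<open>Matrix powers and the scalar inequalities behind the criteria\<close>

lemma mat_rpow_conj_diag:
  assumes U: "U \<in> carrier_mat n n" and UU: "transpose_mat U * U = 1\<^sub>m n" and l: "\<And>i. i < n \<Longrightarrow> l i > 0"
    and C: "C = U * diag_of n l * transpose_mat U"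
  obtains V k where "V \<in> carrier_mat n n" "transpose_mat V * V = 1\<^sub>m n" "\<And>i. i < n \<Longrightarrow> k i > 0"
    "C = V * diag_of n k * transpose_mat V" "mat_rpow C p = V * diag_of n (\<lambda>i. k i powr p) * transpose_mat V"
proof -
  have n: "dim_row C = n" using U C by simp
  let ?Q = "\<lambda>P. \<exists>U l. U \<in> carrier_mat n n \<and> transpose_mat U * U = 1\<^sub>m n \<and> (\<forall>i < n. l i > 0)
       \<and> C = U * diag_of n l * transpose_mat U
       \<and> P = U * diag_of n (\<lambda>i. l i powr p) * transpose_mat U"
  have "?Q (U * diag_of n (\<lambda>i. l i powr p) * transpose_mat U)" using assms by blast
  \<comment> \<open>The given decomposition only witnesses existence. The one behind
    \<open>mat_rpow\<close> may differ from it, so it is returned as new data \<open>V\<close>,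
    \<open>k\<close>.\<close>
  then have "?Q (mat_rpow C p)" unfolding mat_rpow_def n by (rule someI)
  then show thesis using that by blast
qed

text \<open>For negative exponents the power function is convex and lies above its tangent at 1; the
  companion below is the concave case, an instance of Young's inequality with weights
  \<open>p\<close> and \<open>1 - p\<close>.\<close>

lemma powr_ge_tangent:
  assumes "p < 0" "(l::real) > 0"
  shows "1 + p * (l - 1) \<le> l powr p"
proof -
  have "p * (l - 1) \<le> p * ln l" using assms ln_le_minus_one[of l] by (intro mult_left_mono_neg) auto
  also have "1 + p * ln l \<le> exp (p * ln l)" by (rule exp_ge_add_one_self)
  finally show ?thesis using assms by (simp add: powr_def)
qed

lemma powr_le_tangent:
  assumes "0 < p" "p < 1" "(l::real) > 0"
  shows "l powr p \<le> 1 + p * (l - 1)"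
  using Youngs_inequality_0[of p "1 - p" l 1] assms by (simp add: algebra_simps)

text \<open>Summing tangents turns the bound on the sum into one on the power sum. For
  \<open>p < 0\<close> the power sum is at least \<open>s\<close>, but the outer exponent
  \<open>1 / p\<close> is negative as well and reverses the inequality again.\<close>

lemma power_mean_le:
  fixes l :: "nat \<Rightarrow> real"
  assumes p: "p \<noteq> 0" "p < 1" and s: "s > 0" and l: "\<And>i. i < s \<Longrightarrow> l i > 0" and sum: "(\<Sum>i<s. l i) \<le> real s"
  shows "(\<Sum>i<s. l i powr p) powr (1 / p) \<le> real s powr (1 / p)"
proof -
  have tangent: "(\<Sum>i<s. 1 + p * (l i - 1)) = real s + p * ((\<Sum>i<s. l i) - real s)"
    by (simp add: sum.distrib sum_distrib_left[symmetric] sum_subtractf)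
  show ?thesis
  proof (cases "p > 0")
    case True
    have "(\<Sum>i<s. l i powr p) \<le> (\<Sum>i<s. 1 + p * (l i - 1))"
      using powr_le_tangent[OF True p(2)] l by (intro sum_mono) auto
    also have "\<dots> \<le> real s" unfolding tangent using True sum by (simp add: mult_nonneg_nonpos)
    finally show ?thesis using True by (intro powr_mono2 sum_nonneg) auto
  next
    case False
    then have neg: "p < 0" using p by simp
    have "real s \<le> (\<Sum>i<s. 1 + p * (l i - 1))"
      unfolding tangent using neg sum by (simp add: mult_nonpos_nonpos)
    also have "\<dots> \<le> (\<Sum>i<s. l i powr p)"
      using powr_ge_tangent[OF neg] l by (intro sum_mono) auto
    finally show ?thesis using neg s by (intro powr_mono2') auto
  qed
qed

text \<open>A form of the arithmetic-geometric mean inequality, from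
  \<open>l \<le> exp (l - 1)\<close> factor by factor.\<close>

lemma prod_le_one:
  fixes l :: "nat \<Rightarrow> real"
  assumes "\<And>i. i < s \<Longrightarrow> l i > 0" and "(\<Sum>i<s. l i) \<le> real s"
  shows "(\<Prod>i<s. l i) \<le> 1"
proof -
  have "l i \<le> exp (l i - 1)" for i using exp_ge_add_one_self[of "l i - 1"] by simp
  then have "(\<Prod>i<s. l i) \<le> (\<Prod>i<s. exp (l i - 1))"
    using assms(1) by (intro prod_mono) (auto simp: less_imp_le)
  also have "\<dots> = exp ((\<Sum>i<s. l i) - real s)" by (simp add: exp_sum[symmetric] sum_subtractf)
  also have "\<dots> \<le> 1" using assms(2) by simp
  finally show ?thesis .
qed

text \<open>Serves to evaluate \<open>mat_rpow\<close> at the identity, where the chosen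
  diagonalization has an unknown orthogonal factor but necessarily unit eigenvalues.\<close>

lemma conj_diag_one:
  assumes U: "U \<in> carrier_mat n n" and UU: "transpose_mat U * U = 1\<^sub>m n"
    and one: "1\<^sub>m n = U * diag_of n l * transpose_mat U" and k: "k < n"
  shows "l k = 1"
proof -
  have "transpose_mat U * (U * diag_of n l * transpose_mat U) * U = (transpose_mat U * U) * diag_of n l * (transpose_mat U * U)"
    using U by (simp add: assoc_mult_mat[of _ n n _ n _ n] mult_carrier_mat[of _ n n])
  then have "diag_of n l = 1\<^sub>m n"
    unfolding one[symmetric] UU using U UU
    by (simp add: left_mult_one_mat[of _ n n] right_mult_one_mat[of _ n n])
  from arg_cong[OF this, of "\<lambda>A. A $$ (k, k)"] show ?thesis using k by (simp add: diag_of_def)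
qed

lemma Phi_le_of_trace_le:
  assumes U: "U \<in> carrier_mat s s" and UU: "transpose_mat U * U = 1\<^sub>m s" and s: "s > 0"
    and l: "\<And>k. k < s \<Longrightarrow> l k > 0" and C: "C_K d K \<eta> = U * diag_of s l * transpose_mat U"
    and tr: "mat_trace (C_K d K \<eta>) \<le> real s" and C1: "C_K d K \<xi> = 1\<^sub>m s" and p: "p < 1"
  shows "Phi d K p \<eta> \<le> Phi d K p \<xi>"
proof -
  have sum: "(\<Sum>k<s. l k) \<le> real s" using tr unfolding C mat_trace_conj_diag[OF U UU] .
  have Cc: "C_K d K \<eta> \<in> carrier_mat s s" unfolding C using U by (simp add: mult_carrier_mat[of _ s s])
  consider "p = -\<infinity>" | "p = 0" | r where "p = ereal r" "r \<noteq> 0" "r < 1"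
    using p by (cases p) auto
  then show ?thesis
  proof cases
    case 1
    have "char_poly (C_K d K \<eta>) \<noteq> 0" using degree_monic_char_poly[OF Cc] by auto
    then have "finite {e. poly (char_poly (C_K d K \<eta>)) e = 0}" by (rule poly_roots_finite)
    then have fin: "finite {e. eigenvalue (C_K d K \<eta>) e}" using eigenvalue_root_char_poly[OF Cc] by simp
    \<comment> \<open>The least eigenvalue is at most the average of all of them, which is at most
      1.\<close>
    have "lambda_min (C_K d K \<eta>) \<le> l k" if "k < s" for k
      unfolding lambda_min_def using conj_diag_eigenvalue[OF U UU that] by (intro Min_le[OF fin]) (simp add: C)
    then have "(\<Sum>k<s. lambda_min (C_K d K \<eta>)) \<le> (\<Sum>k<s. l k)" by (intro sum_mono) simp
    then have "real s * lambda_min (C_K d K \<eta>) \<le> real s * 1" using sum by simp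
    then have "lambda_min (C_K d K \<eta>) \<le> 1" using s by (simp only: mult_le_cancel_left_pos of_nat_0_less_iff)
    moreover have "{e. eigenvalue (1\<^sub>m s :: real mat) e} = {1}"
    proof -
      have "e = 1" if ev: "eigenvector (1\<^sub>m s :: real mat) v e" for e v
      proof (rule ccontr)
        assume e: "e \<noteq> 1"
        have v: "v \<in> carrier_vec s" "v \<noteq> 0\<^sub>v s" "v = e \<cdot>\<^sub>v v" using ev by (auto simp: eigenvector_def)
        have "v $ i = 0" if "i < s" for i
          using arg_cong[OF v(3), of "\<lambda>v. v $ i"] that v(1) e by simp
        then have "v = 0\<^sub>v s" using v(1) by (intro eq_vecI) auto
        with v(2) show False by simp
      qed
      moreover have "eigenvalue (1\<^sub>m s :: real mat) 1"
        using conj_diag_eigenvalue[of "1\<^sub>m s" s 0 "\<lambda>_. 1"] s diag_of_one[of s "\<lambda>_. 1"] by simp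
      ultimately show ?thesis by (auto simp: eigenvalue_def)
    qed
    ultimately show ?thesis using 1 by (simp add: Phi_def C1 lambda_min_def)
  next
    case 2
    then show ?thesis
      using prod_le_one[OF l sum] by (simp add: Phi_def C1 C det_conj_diag[OF U UU])
  next
    case (3 r)
    obtain V k where V: "V \<in> carrier_mat s s" and VV: "transpose_mat V * V = 1\<^sub>m s"
      and kpos: "\<And>i. i < s \<Longrightarrow> k i > 0" and CV: "C_K d K \<eta> = V * diag_of s k * transpose_mat V"
      and pow: "mat_rpow (C_K d K \<eta>) r = V * diag_of s (\<lambda>i. k i powr r) * transpose_mat V"
      using mat_rpow_conj_diag[OF U UU l C] by blast
    \<comment> \<open>The trace bound is read off again for the eigenvalues \<open>k\<close>, since
      these belong to the decomposition chosen by \<open>mat_rpow\<close>.\<close>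
    have sumk: "(\<Sum>i<s. k i) \<le> real s" using tr unfolding CV mat_trace_conj_diag[OF V VV] .
    have id: "1\<^sub>m s = 1\<^sub>m s * diag_of s (\<lambda>_. 1) * transpose_mat (1\<^sub>m s :: real mat)"
      using diag_of_one[of s "\<lambda>_. 1"] by simp
    obtain V1 k1 where V1: "V1 \<in> carrier_mat s s" and VV1: "transpose_mat V1 * V1 = 1\<^sub>m s"
      and CV1: "1\<^sub>m s = V1 * diag_of s k1 * transpose_mat V1"
      and pow1: "mat_rpow (1\<^sub>m s) r = V1 * diag_of s (\<lambda>i. k1 i powr r) * transpose_mat V1"
      using mat_rpow_conj_diag[OF one_carrier_mat _ _ id, of r thesis] by simp
    have "mat_trace (mat_rpow (1\<^sub>m s) r) = (\<Sum>i<s. k1 i powr r)"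
      unfolding pow1 mat_trace_conj_diag[OF V1 VV1] ..
    also have "\<dots> = real s" using conj_diag_one[OF V1 VV1 CV1] by simp
    finally have "Phi d K p \<xi> = real s powr (1 / r)" using 3 by (simp add: Phi_def C1)
    moreover have "Phi d K p \<eta> = (\<Sum>i<s. k i powr r) powr (1 / r)"
      using 3 by (simp add: Phi_def pow mat_trace_conj_diag[OF V VV])
    ultimately show ?thesis using power_mean_le[OF 3(2,3) s kpos sumk] by simp
  qed
qed

text \<open>The quadratic form at \<open>v\<close> is the integral of the square of the regression
  function with coefficient vector \<open>v\<close>.\<close>

lemma info_mat_psd:
  assumes "design \<eta>"
  shows "psd (sh_dim d) (info_mat d \<eta>)"
  unfolding psd_def
proof (intro conjI ballI)
  let ?M = "info_mat d \<eta>"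
  show M: "?M \<in> carrier_mat (sh_dim d) (sh_dim d)" by (simp add: info_mat_def)
  show "transpose_mat ?M = ?M"
    by (rule eq_matI) (auto simp: info_mat_def mult.commute)
  fix v :: "real vec" assume v: "v \<in> carrier_vec (sh_dim d)"
  note int = design_integrable[OF assms]
  let ?n = "sh_dim d"
  have "v \<bullet> (?M *\<^sub>v v) = (\<Sum>i<?n. \<Sum>j<?n. v $ i * (v $ j * (LINT x|\<eta>. sh_f i x * sh_f j x)))"
    using v M by (simp add: scalar_prod_def lessThan_atLeast0 sum_distrib_left info_mat_def mult_ac)
  also have "\<dots> = (LINT x|\<eta>. (\<Sum>i<?n. \<Sum>j<?n. v $ i * (v $ j * (sh_f i x * sh_f j x))))"
    using int by simp
  also have "\<dots> = (LINT x|\<eta>. (\<Sum>i<?n. v $ i * sh_f i x)\<^sup>2)"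
    by (simp add: power2_eq_square sum_product mult_ac)
  also have "\<dots> \<ge> 0" by (rule integral_nonneg_AE) simp
  finally show "0 \<le> v \<bullet> (?M *\<^sub>v v)" .
qed

section \<open>The selected coefficients and the optimality theorem\<close>

lemma length_sel_indices: "length (sel_indices ks) = (\<Sum>k\<leftarrow>ks. 2 * k + 1)"
  unfolding sel_indices_def by (simp add: length_concat o_def power2_eq_square mult_2)

lemma sel_indices_Cons: "sel_indices (k # ks) = [k\<^sup>2..<(k + 1)\<^sup>2] @ sel_indices ks"
  by (simp add: sel_indices_def)

lemma set_sel_indices: "set (sel_indices ks) = (\<Union>k\<in>set ks. {k\<^sup>2..<(k + 1)\<^sup>2})"
  by (simp add: sel_indices_def)

lemma distinct_sel_indices: "distinct ks \<Longrightarrow> distinct (sel_indices ks)"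
proof (induction ks)
  case (Cons k ks)
  have "i \<notin> set (sel_indices ks)" if "i \<in> {k\<^sup>2..<(k + 1)\<^sup>2}" for i
  proof
    assume "i \<in> set (sel_indices ks)"
    then obtain k' where "k' \<in> set ks" "i \<in> {k'\<^sup>2..<(k' + 1)\<^sup>2}" by (auto simp: set_sel_indices)
    moreover have "k' = k" using sh_deg_eq[OF that] sh_deg_eq[OF calculation(2)] by simp
    ultimately show False using Cons.prems by simp
  qed
  then show ?case using Cons by (auto simp: sel_indices_Cons simp del: upt_Suc)
qed (simp add: sel_indices_def)

lemma sel_indices_less:
  assumes "\<forall>k \<in> set ks. k \<le> d" "i \<in> set (sel_indices ks)"
  shows "i < sh_dim d"
proof -
  obtain k where "k \<le> d" "i < (k + 1)\<^sup>2" using assms by (auto simp: set_sel_indices)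
  then show ?thesis unfolding sh_dim_def by (meson add_le_mono1 less_le_trans power_mono zero_le)
qed

text \<open>Over each degree block the integrand is the constant \<open>2 k + 1\<close> by the
  addition theorem, and a design has total mass 1.\<close>

lemma sum_info_sel_indices:
  assumes "design \<eta>"
  shows "(\<Sum>i\<leftarrow>sel_indices ks. LINT x|\<eta>. sh_f i x * sh_f i x) = real (length (sel_indices ks))"
proof (induction ks)
  case (Cons k ks)
  interpret prob_space \<eta> using assms by (simp add: design_def)
  have "(\<Sum>i\<leftarrow>[k\<^sup>2..<(k + 1)\<^sup>2]. LINT x|\<eta>. sh_f i x * sh_f i x)
     = (\<Sum>i\<in>{k\<^sup>2..<(k + 1)\<^sup>2}. LINT x|\<eta>. sh_f i x * sh_f i x)"
    by (simp only: sum_list_distinct_conv_sum_set[OF distinct_upt] set_upt)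
  also have "\<dots> = (LINT x|\<eta>. (\<Sum>i\<in>{k\<^sup>2..<(k + 1)\<^sup>2}. sh_f i x * sh_f i x))"
    using design_integrable[OF assms] by simp
  also have "\<dots> = 2 * real k + 1"
    unfolding power2_eq_square[symmetric, of "sh_f _ _"] sum_sh_f_square by (simp add: prob_space)
  finally show ?case
    unfolding sel_indices_Cons map_append sum_list_append Cons length_append length_upt
    by (simp add: power2_eq_square)
qed (simp add: sel_indices_def)

lemma sel_matrix_conj:
  assumes "M \<in> carrier_mat (sh_dim d) (sh_dim d)" and "\<forall>k \<in> set ks. k \<le> d"
    and i: "i < length (sel_indices ks)" and j: "j < length (sel_indices ks)"
  shows "(transpose_mat (sel_matrix d ks) * M * sel_matrix d ks) $$ (i, j)
     = M $$ (sel_indices ks ! i, sel_indices ks ! j)"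
proof -
  let ?n = "sh_dim d" and ?K = "sel_matrix d ks" and ?s = "length (sel_indices ks)"
  have K: "?K \<in> carrier_mat ?n ?s" by (simp add: sel_matrix_def)
  have less: "sel_indices ks ! m < ?n" if "m < ?s" for m
    using sel_indices_less[OF assms(2)] that by simp
  define A where "A = transpose_mat ?K * M"
  have A: "A \<in> carrier_mat ?s ?n" using K assms(1) by (simp add: A_def)
  have "A $$ (i, m) = (\<Sum>r<?n. if r = sel_indices ks ! i then M $$ (r, m) else 0)" if "m < ?n" for m
  proof -
    have "A $$ (i, m) = (\<Sum>r<?n. (if r = sel_indices ks ! i then 1 else 0) * M $$ (r, m))"
      using that K assms(1) i unfolding A_def by (simp add: scalar_prod_def lessThan_atLeast0 sel_matrix_def)
    then show ?thesis by (simp add: if_distrib[of "\<lambda>c. c * _"] cong: if_cong)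
  qed
  then have Ai: "A $$ (i, m) = M $$ (sel_indices ks ! i, m)" if "m < ?n" for m
    using that less[OF i] by simp
  have "(A * ?K) $$ (i, j) = (\<Sum>r<?n. A $$ (i, r) * (if r = sel_indices ks ! j then 1 else 0))"
    using K A i j by (simp add: scalar_prod_def lessThan_atLeast0 sel_matrix_def)
  also have "\<dots> = A $$ (i, sel_indices ks ! j)"
    using less[OF j] by (simp add: if_distrib[of "\<lambda>c. _ * c"] cong: if_cong)
  finally show ?thesis using Ai less[OF j] by (simp add: A_def)
qed

theorem theorem2p1:
  fixes d :: nat and p :: ereal and ks :: "nat list"
  assumes "d \<ge> 1"
    and "p < 1"
    and "ks \<noteq> []"
    and "sorted_wrt (<) ks"
    and "\<forall>k \<in> set ks. k \<le> d"
  shows "phi_optimal d (sel_matrix d ks) p xi_unif \<and> info_mat d xi_unif = 1\<^sub>m (sh_dim d)"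
proof
  let ?n = "sh_dim d" and ?K = "sel_matrix d ks"
  define s where "s = length (sel_indices ks)"
  have "sum_list (map (\<lambda>k. 2 * k + 1) ks) > 0" using assms(3) by (cases ks) auto
  then have s0: "s > 0" by (simp add: s_def length_sel_indices)
  have K: "?K \<in> carrier_mat ?n s" by (simp add: sel_matrix_def s_def)
  have dist: "distinct (sel_indices ks)"
    using assms(4) distinct_sel_indices by (simp add: strict_sorted_iff)
  have less: "sel_indices ks ! m < ?n" if "m < s" for m
    using sel_indices_less[OF assms(5)] that by (simp add: s_def)
  have KK: "transpose_mat ?K * ?K = 1\<^sub>m s"
  proof (rule eq_matI)
    fix i j assume "i < dim_row (1\<^sub>m s :: real mat)" "j < dim_col (1\<^sub>m s :: real mat)"
    then have ij: "i < s" "j < s" by auto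
    \<comment> \<open>The inserted identity makes this an instance of
      \<open>sel_matrix_conj\<close>; distinct selected indices then give the identity of size
      \<open>s\<close>.\<close>
    have "(transpose_mat ?K * ?K) $$ (i, j) = (transpose_mat ?K * 1\<^sub>m ?n * ?K) $$ (i, j)"
      using right_mult_one_mat[of "transpose_mat ?K" s ?n] K by simp
    also have "\<dots> = 1\<^sub>m ?n $$ (sel_indices ks ! i, sel_indices ks ! j)"
      using ij assms(5) by (intro sel_matrix_conj) (auto simp: s_def)
    finally show "(transpose_mat ?K * ?K) $$ (i, j) = 1\<^sub>m s $$ (i, j)"
      using ij less[of i] less[of j] dist by (simp add: nth_eq_iff_index_eq s_def)
  qed (use K in auto)
  show "info_mat d xi_unif = 1\<^sub>m ?n" by (rule info_mat_xi_unif)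
  \<comment> \<open>The defining equation \<open>M G M = M\<close> leaves no choice when
    \<open>M\<close> is the identity.\<close>
  have "gen_inverse (1\<^sub>m ?n) = 1\<^sub>m ?n"
    using gen_inverse_symmetric[of "1\<^sub>m ?n" ?n] left_mult_one_mat[of "gen_inverse (1\<^sub>m ?n)" ?n ?n]
      right_mult_one_mat[of "gen_inverse (1\<^sub>m ?n)" ?n ?n] by simp
  then have "transpose_mat ?K * gen_inverse (info_mat d xi_unif) * ?K = 1\<^sub>m s"
    using KK K right_mult_one_mat[of "transpose_mat ?K" s ?n] by (simp add: info_mat_xi_unif)
  then have C1: "C_K d ?K xi_unif = 1\<^sub>m s"
    unfolding C_K_def by (simp add: mat_inv_eq[of _ s])
  show "phi_optimal d ?K p xi_unif"
    unfolding phi_optimal_def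
  proof (intro conjI allI impI)
    show "design xi_unif" by (rule design_xi_unif)
    show "estimable d ?K xi_unif"
    proof -
      have "?K *\<^sub>v x \<in> mat_range (1\<^sub>m ?n)" if "x \<in> carrier_vec s" for x
        using K that unfolding mat_range_def by (intro CollectI exI[of _ "?K *\<^sub>v x"]) simp
      then show ?thesis using K unfolding estimable_def info_mat_xi_unif by (auto simp: mat_range_def[of ?K])
    qed
  next
    fix \<eta> assume "design \<eta> \<and> estimable d ?K \<eta>"
    then have des: "design \<eta>" and sub: "mat_range ?K \<subseteq> mat_range (info_mat d \<eta>)"
      by (auto simp: estimable_def)
    obtain W l where W: "W \<in> carrier_mat s s" "transpose_mat W * W = 1\<^sub>m s" "\<And>k. k < s \<Longrightarrow> l k > 0"
      and C: "C_K d ?K \<eta> = W * diag_of s l * transpose_mat W"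
      and le: "\<And>j. j < s \<Longrightarrow> C_K d ?K \<eta> $$ (j, j) \<le> (transpose_mat ?K * info_mat d \<eta> * ?K) $$ (j, j)"
      using estimable_information_inverse[OF info_mat_psd[OF des] K KK sub] unfolding C_K_def by metis
    have "mat_trace (C_K d ?K \<eta>) = (\<Sum>j<s. C_K d ?K \<eta> $$ (j, j))"
      using W(1) by (simp add: mat_trace_def C)
    also have "\<dots> \<le> (\<Sum>j<s. (transpose_mat ?K * info_mat d \<eta> * ?K) $$ (j, j))"
      by (intro sum_mono le) simp
    also have "\<dots> = (\<Sum>j<s. info_mat d \<eta> $$ (sel_indices ks ! j, sel_indices ks ! j))"
      using assms(5) by (intro sum.cong sel_matrix_conj) (auto simp: s_def info_mat_def)
    also have "\<dots> = (\<Sum>j<s. LINT x|\<eta>. sh_f (sel_indices ks ! j) x * sh_f (sel_indices ks ! j) x)"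
      using less by (simp add: info_mat_def)
    also have "\<dots> = (\<Sum>i\<leftarrow>sel_indices ks. LINT x|\<eta>. sh_f i x * sh_f i x)"
      by (simp add: sum_list_sum_nth s_def lessThan_atLeast0)
    also have "\<dots> = real s" using sum_info_sel_indices[OF des] by (simp add: s_def)
    finally show "Phi d ?K p \<eta> \<le> Phi d ?K p xi_unif"
      using Phi_le_of_trace_le[OF W(1,2) s0 W(3) C _ C1 assms(2)] by simp
  qed
qed

end
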